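(* Let $x$ be an involution in $S_n$. Then $\mathcal{A}(x)^{-1}=\{u\in S_n:\hat0(x)\preceq_{\mathcal{A}}u\}=\{u\in S_n:u\preceq_{\mathcal{A}}\hat1(x)\}$.
   Context: $S_n$ is the Coxeter group with simple generators $s_i=(i,i+1)$ and length $\ell$; permutations are identified with one-line sequences $[w(1),\dots,w(n)]$. The Demazure product $\circ$ is the unique associative operation on $S_n$ with $s\circ w = sw$ if $\ell(sw)>\ell(w)$ and $s\circ w=w$ otherwise, and $w\circ s=ws$ if $\ell(ws)>\ell(w)$ and $w\circ s = w$ otherwise. $\mathcal{A}(x)$ is the set of minimal-length $w\in S_n$ with $w^{-1}\circ w=x$, and $\mathcal{A}(x)^{-1}=\{u^{-1}:u\in\mathcal{A}(x)\}$. $\prec_{\mathcal{A}}$ is the transitive closure of the relation on integer sequences with $[\cdots,c,a,b,\cdots]\prec_{\mathcal{A}}[\cdots,b,c,a,\cdots]$ when $a\le b\le c$ (same consecutive positions, other entries equal); $\preceq_{\mathcal{A}}$ means $\prec_{\mathcal{A}}$ or equal. Let $\mathrm{Cyc}(x)=\{(a,b):a\le b=x(a)\}$, of size $k$; list it as $(a_1,b_1),\dots,(a_k,b_k)$ with $a_1<\dots<a_k$ and as $(c_1,d_1),\dots,(c_k,d_k)$ with $d_1<\dots<d_k$. For a list $L$, $[[L]]$ is $L$ with repeated entries deleted after their first occurrence. Then $\hat0(x)=[[b_1,a_1,b_2,a_2,\dots,b_k,a_k]]$ and $\hat1(x)=[[d_1,c_1,\dots,d_k,c_k]]$, regarded as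 permutations in one-line notation. *)

theory Defs
  imports "HOL-Combinatorics.Permutations"
begin

text \<open>
  Elements of the symmetric group \<open>S\<^sub>n\<close> are functions on \<^typ>\<open>nat\<close> that permute \<open>{1..n}\<close> and fix
  everything else; the product is composition.
\<close>

abbreviation Sn :: "nat \<Rightarrow> (nat \<Rightarrow> nat) set"
  where "Sn n \<equiv> {w. w permutes {1..n}}"

definition simple_refl :: "nat \<Rightarrow> nat \<Rightarrow> nat"
  where "simple_refl i = Transposition.transpose i (Suc i)"

definition simple_gens :: "nat \<Rightarrow> (nat \<Rightarrow> nat) set"
  where "simple_gens n = simple_refl ` {1..<n}"

definition cox_length :: "nat \<Rightarrow> (nat \<Rightarrow> nat) \<Rightarrow> nat"
  where "cox_length n w =
    (LEAST k. \<exists>gs. length gs = k \<and> set gs \<subseteq> simple_gens n \<and> w = foldr (\<circ>) gs id)"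

text \<open>
  The condition on \<^const>\<open>id\<close> follows from the other ones unless \<open>n = 2\<close>. For \<open>n = 2\<close> it
  excludes the associative operation that maps all four pairs to the transposition.
\<close>

definition is_demazure_product ::
    "nat \<Rightarrow> ((nat \<Rightarrow> nat) \<Rightarrow> (nat \<Rightarrow> nat) \<Rightarrow> (nat \<Rightarrow> nat)) \<Rightarrow> bool"
  where "is_demazure_product n f \<longleftrightarrow>
    (\<forall>u\<in>Sn n. \<forall>v\<in>Sn n. f u v \<in> Sn n) \<and>
    (\<forall>u\<in>Sn n. \<forall>v\<in>Sn n. \<forall>w\<in>Sn n. f (f u v) w = f u (f v w)) \<and>
    f id id = id \<and>
    (\<forall>s\<in>simple_gens n. \<forall>w\<in>Sn n.
      f s w = (if cox_length n (s \<circ> w) > cox_length n w then s \<circ> w else w) \<and>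
      f w s = (if cox_length n (w \<circ> s) > cox_length n w then w \<circ> s else w))"

text \<open>
  Such an operation exists and its values on \<open>S\<^sub>n\<close> are unique. \<open>SOME\<close> is used in place of \<open>THE\<close>
  only because its values on arguments outside \<open>S\<^sub>n\<close> are irrelevant and left unconstrained.
\<close>

definition demazure :: "nat \<Rightarrow> (nat \<Rightarrow> nat) \<Rightarrow> (nat \<Rightarrow> nat) \<Rightarrow> (nat \<Rightarrow> nat)"
  where "demazure n = (SOME f. is_demazure_product n f)"

definition atoms :: "nat \<Rightarrow> (nat \<Rightarrow> nat) \<Rightarrow> (nat \<Rightarrow> nat) set"
  where "atoms n x =
    {w. is_arg_min (cox_length n) (\<lambda>v. v \<in> Sn n \<and> demazure n (inv v) v = x) w}"

definition one_line :: "nat \<Rightarrow> (nat \<Rightarrow> nat) \<Rightarrow> nat list"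
  where "one_line n w = map w [1..<Suc n]"

inductive stepA :: "'a::linorder list \<Rightarrow> 'a list \<Rightarrow> bool"
  where "a \<le> b \<Longrightarrow> b \<le> c \<Longrightarrow> stepA (us @ [c, a, b] @ vs) (us @ [b, c, a] @ vs)"

definition precA :: "'a::linorder list \<Rightarrow> 'a list \<Rightarrow> bool"
  where "precA = stepA\<^sup>+\<^sup>+"

definition preceqA :: "'a::linorder list \<Rightarrow> 'a list \<Rightarrow> bool"
  where "preceqA us vs \<longleftrightarrow> precA us vs \<or> us = vs"

definition Cyc :: "nat \<Rightarrow> (nat \<Rightarrow> nat) \<Rightarrow> (nat \<times> nat) set"
  where "Cyc n x = {(a, b). a \<in> {1..n} \<and> b \<in> {1..n} \<and> a \<le> b \<and> b = x a}"

text \<open>\<^const>\<open>remdups\<close> keeps the last occurrence of each entry; here the first one is kept.\<close>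

definition remdups_keep_first :: "'a list \<Rightarrow> 'a list"
  where "remdups_keep_first xs = rev (remdups (rev xs))"

definition hat0 :: "nat \<Rightarrow> (nat \<Rightarrow> nat) \<Rightarrow> nat list"
  where "hat0 n x =
    remdups_keep_first (concat (map (\<lambda>(a, b). [b, a]) (sorted_key_list_of_set fst (Cyc n x))))"

definition hat1 :: "nat \<Rightarrow> (nat \<Rightarrow> nat) \<Rightarrow> nat list"
  where "hat1 n x =
    remdups_keep_first (concat (map (\<lambda>(c, d). [d, c]) (sorted_key_list_of_set snd (Cyc n x))))"

end

theory Submission
  imports Defs
begin

text \<open>
  Write \<open>D u\<close> for the Demazure product of \<open>u\<close> and its inverse, so that inverse atoms of \<open>x\<close> are the shortest
  \<open>u\<close> with \<open>D u = x\<close>. If \<open>v\<close> has entries \<open>a < b < c\<close> at consecutive positions, rearranging them to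
  \<open>c,a,b\<close> or \<open>b,c,a\<close> or \<open>c,b,a\<close> gives permutations with the same \<open>D\<close>, by the braid relation, and the last
  one is longer. Hence inverse atoms are closed under both directions of the generating relation and
  contain no consecutive descending \<open>c,b,a\<close>. An inverse atom that is minimal for the order also contains no \<open>b,c,a\<close>,
  which forces its word to consist of blocks \<open>b a\<close> and \<open>a\<close> with increasing last entries, i.e. to be
  \<open>hat0 y\<close> for some involution \<open>y\<close>; likewise maximal ones have the form \<open>hat1 y\<close>. Finally \<open>D\<close> maps both
  of these permutations to \<open>y\<close>, so \<open>y = x\<close>: removing a left descent from a word made of cycles of \<open>y\<close>
  gives such a word for an involution with fewer inversions.
\<close>

subsection \<open>Length and inversions\<close>

lemma simple_refl_simps [simp]:
  "simple_refl i i = Suc i" "simple_refl i (Suc i) = i"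
  "j \<noteq> i \<Longrightarrow> j \<noteq> Suc i \<Longrightarrow> simple_refl i j = j"
  by (auto simp: simple_refl_def)

lemma simple_refl_involutory [simp]:
  "simple_refl i (simple_refl i j) = j" "simple_refl i \<circ> simple_refl i = id"
  by (auto simp: simple_refl_def)

lemma bij_simple_refl [simp]: "bij (simple_refl i)"
  by (simp add: simple_refl_def)

lemma inv_simple_refl [simp]: "inv (simple_refl i) = simple_refl i"
  by (simp add: simple_refl_def)

lemma simple_refl_eq_iff [simp]: "simple_refl i p = simple_refl i q \<longleftrightarrow> p = q"
  by (metis simple_refl_involutory(1))

lemma simple_refl_cancel [simp]:
  "simple_refl i \<circ> (simple_refl i \<circ> w) = w" "(w \<circ> simple_refl i) \<circ> simple_refl i = w"
  by (simp_all add: fun_eq_iff)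

lemma simple_refl_permutes: "i \<in> {1..<n} \<Longrightarrow> simple_refl i \<in> Sn n"
  unfolding simple_refl_def by (auto intro: permutes_swap_id)

lemma Sn_compose: "u \<in> Sn n \<Longrightarrow> v \<in> Sn n \<Longrightarrow> u \<circ> v \<in> Sn n"
  by (auto intro: permutes_compose)

lemma Sn_inv: "u \<in> Sn n \<Longrightarrow> inv u \<in> Sn n"
  by (auto intro: permutes_inv)

lemma Sn_id: "id \<in> Sn n"
  by (auto intro: permutes_id)

lemma inv_comp_simple_refl: "bij w \<Longrightarrow> inv (w \<circ> simple_refl i) = simple_refl i \<circ> inv w"
  by (simp add: o_inv_distrib)

lemma inv_simple_refl_comp: "bij w \<Longrightarrow> inv (simple_refl i \<circ> w) = inv w \<circ> simple_refl i"
  by (simp add: o_inv_distrib)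

text \<open>No number lies strictly between \<open>i\<close> and \<open>Suc i\<close>, so exchanging
  them can only disturb the comparison of these two.\<close>

lemma simple_refl_mono:
  "p < q \<Longrightarrow> (p, q) \<noteq> (i, Suc i) \<Longrightarrow> simple_refl i p < simple_refl i q"
  by (auto simp: simple_refl_def transpose_def)

text \<open>Positions range over all of \<open>nat\<close>; a permutation of \<open>{1..n}\<close>
  fixes every other point, so for it only positions in \<open>{1..n}\<close> contribute.\<close>

definition inversions :: "(nat \<Rightarrow> nat) \<Rightarrow> (nat \<times> nat) set"
  where "inversions w = {(i, j). i < j \<and> w j < w i}"

lemma inversions_id [simp]: "inversions id = {}"
  by (auto simp: inversions_def)

lemma finite_inversions: assumes "w \<in> Sn n" shows "finite (inversions w)"
proof (rule finite_subset)
  have w: "w permutes {1..n}" using assms by simp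
  show "inversions w \<subseteq> {0..n} \<times> {0..n}"
  proof clarify
    fix i j assume "(i, j) \<in> inversions w"
    then have ij: "i < j" "w j < w i" by (auto simp: inversions_def)
    have "j \<le> n"
    proof (rule ccontr)
      assume "\<not> j \<le> n"
      then have "w j = j" using permutes_not_in[OF w] by auto
      with ij have "i < w i" "n < w i" using \<open>\<not> j \<le> n\<close> by auto
      then show False
        by (metis atLeastAtMost_iff less_irrefl not_le permutes_in_image permutes_not_in w)
    qed
    with ij show "i \<in> {0..n} \<and> j \<in> {0..n}" by auto
  qed
qed auto

text \<open>Renaming positions by \<open>simple_refl i\<close> carries the inversions of
  \<open>w\<close> to inversions of the product, and the ascent at \<open>i\<close> supplies the one
  extra inversion \<open>(i, Suc i)\<close>.\<close>

lemma card_inversions_up: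
  assumes "w \<in> Sn n" "w i < w (Suc i)"
  shows "card (inversions (w \<circ> simple_refl i)) = Suc (card (inversions w))"
proof -
  let ?s = "map_prod (simple_refl i) (simple_refl i)"
  have "inversions (w \<circ> simple_refl i) = insert (i, Suc i) (?s ` inversions w)"
  proof (intro equalityI subsetI)
    fix z assume z: "z \<in> inversions (w \<circ> simple_refl i)"
    obtain p q where pq: "z = (p, q)" by fastforce
    show "z \<in> insert (i, Suc i) (?s ` inversions w)"
    proof (cases "(p, q) = (i, Suc i)")
      case False
      with z pq have "(simple_refl i p, simple_refl i q) \<in> inversions w"
        by (auto simp: inversions_def intro: simple_refl_mono)
      then have "?s (simple_refl i p, simple_refl i q) \<in> ?s ` inversions w" by (rule imageI)
      then show ?thesis by (simp add: pq)
    qed (use pq in auto)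
  next
    fix z assume "z \<in> insert (i, Suc i) (?s ` inversions w)"
    then consider "z = (i, Suc i)" | p q where "(p, q) \<in> inversions w" "z = ?s (p, q)"
      by fastforce
    then show "z \<in> inversions (w \<circ> simple_refl i)"
    proof cases
      case 2
      then have "(p, q) \<noteq> (i, Suc i)" using assms by (auto simp: inversions_def)
      with 2 show ?thesis using simple_refl_mono[of p q i] by (auto simp: inversions_def)
    qed (use assms in \<open>auto simp: inversions_def\<close>)
  qed
  \<comment> \<open>Its preimage under the renaming would be \<open>(Suc i, i)\<close>, which is not
    an increasing pair of positions.\<close>
  moreover have "(i, Suc i) \<notin> ?s ` inversions w"
  proof
    assume "(i, Suc i) \<in> ?s ` inversions w"
    then obtain p q where "(p, q) \<in> inversions w" "simple_refl i p = i" "simple_refl i q = Suc i"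
      by auto
    then show False
      by (metis (no_types, lifting) case_prodD inversions_def mem_Collect_eq not_less_eq
          less_Suc_eq simple_refl_involutory(1) simple_refl_simps(1,2) lessI order_less_asym)
  qed
  moreover have "inj_on ?s (inversions w)" by (auto simp: inj_on_def)
  ultimately show ?thesis using finite_inversions[OF assms(1)] by (simp add: card_image)
qed

lemma card_inversions_down:
  assumes "w \<in> Sn n" "w (Suc i) < w i" "i \<in> {1..<n}"
  shows "card (inversions w) = Suc (card (inversions (w \<circ> simple_refl i)))"
proof -
  have "w \<circ> simple_refl i \<in> Sn n" using assms by (metis Sn_compose simple_refl_permutes)
  from card_inversions_up[OF this, of i] assms show ?thesis by (simp)
qed

lemma Sn_neq_Suc: "w \<in> Sn n \<Longrightarrow> w i \<noteq> w (Suc i)"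
  by (metis mem_Collect_eq n_not_Suc_n permutes_inj injD)

lemma ex_descent:
  assumes "w \<in> Sn n" "w \<noteq> id"
  shows "\<exists>i\<in>{1..<n}. w (Suc i) < w i"
proof (rule ccontr)
  assume a: "\<not> ?thesis"
  have w: "w permutes {1..n}" using assms by simp
  \<comment> \<open>Without a descent the values increase along \<open>{1..n}\<close>, so each is at
    least its index; for a permutation this forces the identity.\<close>
  have "1 \<le> i \<Longrightarrow> i \<le> n \<Longrightarrow> i \<le> w i" for i
  proof (induction i rule: dec_induct)
    case base
    have "w 1 \<in> {1..n}" using base permutes_in_image[OF w, of 1] by auto
    then show ?case by simp
  next
    case (step i)
    then have "w i < w (Suc i)" using a Sn_neq_Suc[OF assms(1), of i]
      by (meson Suc_le_lessD atLeastLessThan_iff not_less_iff_gr_or_eq)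
    with step show ?case by auto
  qed
  then have "w = id" by (intro permutes_natset_ge[OF w]) auto
  with assms show False by simp
qed

lemma foldr_comp_append: "foldr (\<circ>) (gs @ hs) id = foldr (\<circ>) gs id \<circ> foldr (\<circ>) hs id"
  by (induction gs) (simp_all add: comp_assoc)

text \<open>A right factor changes the number of inversions by exactly one, so no word is shorter
  than this number; removing descents one at a time yields a word that attains it.\<close>

lemma cox_length_eq:
  assumes "w \<in> Sn n"
  shows "cox_length n w = card (inversions w)"
proof -
  have upper: "foldr (\<circ>) gs id \<in> Sn n \<and> card (inversions (foldr (\<circ>) gs id)) \<le> length gs"
    if "set gs \<subseteq> simple_gens n" for gs
    using that
  proof (induction gs rule: rev_induct)
    case Nil
    have "foldr (\<circ>) [] id = (id :: nat \<Rightarrow> nat)" by simp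
    then show ?case using Sn_id by (metis inversions_id card.empty le0)
  next
    case (snoc g gs)
    let ?w = "foldr (\<circ>) gs id"
    obtain i where i: "i \<in> {1..<n}" "g = simple_refl i" using snoc.prems by (auto simp: simple_gens_def)
    have w: "?w \<in> Sn n" "card (inversions ?w) \<le> length gs"
      using snoc.IH snoc.prems by (simp_all only: set_append Un_subset_iff simp_thms)
    have "foldr (\<circ>) (gs @ [g]) id = ?w \<circ> simple_refl i" by (simp only: foldr_comp_append) (simp add: i)
    moreover have "card (inversions (?w \<circ> simple_refl i)) \<le> Suc (card (inversions ?w))"
      using card_inversions_up[OF w(1), of i] card_inversions_down[OF w(1), of i] i
        Sn_neq_Suc[OF w(1), of i] by (cases "?w i" "?w (Suc i)" rule: linorder_cases) auto
    ultimately show ?case using Sn_compose[OF w(1) simple_refl_permutes[OF i(1)]] w(2)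
      by (metis Suc_le_mono le_trans length_append_singleton)
  qed
  have lower: "\<exists>gs. length gs = k \<and> set gs \<subseteq> simple_gens n \<and> w = foldr (\<circ>) gs id"
    if "w \<in> Sn n" "card (inversions w) = k" for w k
    using that
  proof (induction k arbitrary: w)
    case 0
    have "w = id" using ex_descent[OF 0(1)] card_inversions_down[OF 0(1)] 0(2) by fastforce
    then show ?case by simp
  next
    case (Suc k)
    have "w \<noteq> id" using Suc(3) inversions_id by (metis card.empty nat.distinct(1))
    then obtain i where i: "i \<in> {1..<n}" "w (Suc i) < w i" using ex_descent Suc(2) by blast
    have "w \<circ> simple_refl i \<in> Sn n" using Suc(2) i by (metis Sn_compose simple_refl_permutes)
    moreover have "card (inversions (w \<circ> simple_refl i)) = k"
      using card_inversions_down[OF Suc(2) i(2,1)] Suc(3) by simp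
    ultimately obtain gs where gs: "length gs = k" "set gs \<subseteq> simple_gens n"
        "w \<circ> simple_refl i = foldr (\<circ>) gs id"
      using Suc.IH by blast
    have "w = foldr (\<circ>) (gs @ [simple_refl i]) id"
      by (simp only: foldr_comp_append gs(3)[symmetric]) (simp add: fun_eq_iff)
    moreover have "set (gs @ [simple_refl i]) \<subseteq> simple_gens n"
      using gs(2) i(1) by (simp add: simple_gens_def)
    ultimately show ?case using gs(1) by (metis length_append_singleton)
  qed
  show ?thesis
    unfolding cox_length_def
  proof (rule Least_equality)
    show "\<exists>gs. length gs = card (inversions w) \<and> set gs \<subseteq> simple_gens n \<and> w = foldr (\<circ>) gs id"
      using lower[OF assms] by blast
  qed (use upper in blast)
qed

text \<open>Exchanging positions with values matches the inversions of \<open>w\<close> with those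
  of its inverse.\<close>

lemma cox_length_inv:
  assumes "w \<in> Sn n"
  shows "cox_length n (inv w) = cox_length n w"
proof -
  have w: "bij w" using assms by (auto intro: permutes_bij)
  have "bij_betw (\<lambda>(i, j). (w j, w i)) (inversions w) (inversions (inv w))"
    by (rule bij_betwI[where g = "\<lambda>(i, j). (inv w j, inv w i)"])
      (use w in \<open>auto simp: inversions_def bij_is_inj bij_is_surj surj_f_inv_f\<close>)
  then show ?thesis
    using bij_betw_same_card cox_length_eq[OF assms] cox_length_eq[OF Sn_inv[OF assms]] by metis
qed

lemma cox_length_right:
  assumes "w \<in> Sn n" "i \<in> {1..<n}"
  shows "w i < w (Suc i) \<Longrightarrow> cox_length n (w \<circ> simple_refl i) = Suc (cox_length n w)"
    and "w (Suc i) < w i \<Longrightarrow> Suc (cox_length n (w \<circ> simple_refl i)) = cox_length n w"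
  using assms card_inversions_up[OF assms(1), of i] card_inversions_down[OF assms(1), of i]
    cox_length_eq[OF assms(1)] cox_length_eq[OF Sn_compose[OF assms(1) simple_refl_permutes[OF assms(2)]]]
  by auto

lemma cox_length_left:
  assumes "w \<in> Sn n" "i \<in> {1..<n}"
  shows "inv w i < inv w (Suc i) \<Longrightarrow> cox_length n (simple_refl i \<circ> w) = Suc (cox_length n w)"
    and "inv w (Suc i) < inv w i \<Longrightarrow> Suc (cox_length n (simple_refl i \<circ> w)) = cox_length n w"
proof -
  have b: "bij w" using assms by (auto intro: permutes_bij)
  have "cox_length n (simple_refl i \<circ> w) = cox_length n (inv w \<circ> simple_refl i)"
    using cox_length_inv[OF Sn_compose[OF simple_refl_permutes[OF assms(2)] assms(1)]] b
    by (simp add: inv_simple_refl_comp)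
  then show "inv w i < inv w (Suc i) \<Longrightarrow> cox_length n (simple_refl i \<circ> w) = Suc (cox_length n w)"
    and "inv w (Suc i) < inv w i \<Longrightarrow> Suc (cox_length n (simple_refl i \<circ> w)) = cox_length n w"
    using cox_length_right[OF Sn_inv[OF assms(1)] assms(2)] cox_length_inv[OF assms(1)] by simp_all
qed

subsection \<open>The Demazure product\<close>

text \<open>The Demazure product with a generator, decided by comparing two entries instead of two
  lengths; this form does not mention \<open>n\<close>.\<close>

definition right_dem :: "nat \<Rightarrow> (nat \<Rightarrow> nat) \<Rightarrow> nat \<Rightarrow> nat"
  where "right_dem i w = (if w i < w (Suc i) then w \<circ> simple_refl i else w)"

definition left_dem :: "nat \<Rightarrow> (nat \<Rightarrow> nat) \<Rightarrow> nat \<Rightarrow> nat"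
  where "left_dem i w = (if inv w i < inv w (Suc i) then simple_refl i \<circ> w else w)"

lemma right_dem_Sn: "w \<in> Sn n \<Longrightarrow> i \<in> {1..<n} \<Longrightarrow> right_dem i w \<in> Sn n"
  by (metis Sn_compose right_dem_def simple_refl_permutes)

lemma left_dem_Sn: "w \<in> Sn n \<Longrightarrow> i \<in> {1..<n} \<Longrightarrow> left_dem i w \<in> Sn n"
  by (metis Sn_compose left_dem_def simple_refl_permutes)

text \<open>\<open>left_dem\<close> acts on values and \<open>right_dem\<close> on positions. They
  interact only when positions \<open>j\<close>, \<open>Suc j\<close> carry the values
  \<open>i\<close>, \<open>Suc i\<close>: in increasing order both make the same swap and a second
  application does nothing; in decreasing order both do nothing.\<close>

lemma left_right_dem_commute:
  assumes "bij w"
  shows "left_dem i (right_dem j w) = right_dem j (left_dem i w)"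
proof -
  have iw: "inv w (w p) = p" "w (inv w p) = p" for p
    using assms by (simp_all add: bij_is_inj bij_is_surj surj_f_inv_f)
  have weq: "w p = w q \<longleftrightarrow> p = q" for p q
    using assms by (simp add: bij_is_inj inj_eq)
  consider (up) "w j = i" "w (Suc j) = Suc i" | (down) "w j = Suc i" "w (Suc j) = i"
    | (other) "{w j, w (Suc j)} \<noteq> {i, Suc i}" by (meson doubleton_eq_iff)
  then show ?thesis
  proof cases
    case up
    then have e: "inv w i = j" "inv w (Suc i) = Suc j" using iw(1)[of j] iw(1)[of "Suc j"] by simp_all
    have c: "simple_refl i \<circ> w = w \<circ> simple_refl j"
    proof
      fix p show "(simple_refl i \<circ> w) p = (w \<circ> simple_refl j) p"
        using up weq[of p j] weq[of p "Suc j"] by (cases "p = j"; cases "p = Suc j") auto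
    qed
    have "right_dem j w = w \<circ> simple_refl j" "left_dem i w = w \<circ> simple_refl j"
      using up e c by (simp_all add: right_dem_def left_dem_def)
    moreover have "right_dem j (w \<circ> simple_refl j) = w \<circ> simple_refl j"
      using up by (simp add: right_dem_def)
    moreover have "left_dem i (w \<circ> simple_refl j) = w \<circ> simple_refl j"
      using up e assms by (simp add: left_dem_def inv_comp_simple_refl)
    ultimately show ?thesis by simp
  next
    case down
    then have "inv w i = Suc j" "inv w (Suc i) = j" using iw(1)[of j] iw(1)[of "Suc j"] by simp_all
    with down show ?thesis by (simp add: right_dem_def left_dem_def)
  next
    case other
    \<comment> \<open>Exchanging the values \<open>i\<close> and \<open>Suc i\<close> keeps the
      comparison at \<open>j\<close>, since the two entries there are not exactly this pair.\<close>
    have *: "w j < w (Suc j) \<longleftrightarrow> simple_refl i (w j) < simple_refl i (w (Suc j))"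
      using simple_refl_mono[of "w j" "w (Suc j)" i] simple_refl_mono[of "w (Suc j)" "w j" i]
        other weq[of j "Suc j"] by (auto simp: insert_commute neq_iff)
    have "inv w i \<noteq> inv w (Suc i)" using iw(2) by (metis n_not_Suc_n)
    moreover have "{inv w i, inv w (Suc i)} \<noteq> {j, Suc j}"
    proof
      assume "{inv w i, inv w (Suc i)} = {j, Suc j}"
      then have "w ` {inv w i, inv w (Suc i)} = w ` {j, Suc j}" by simp
      then show False using other by (simp add: iw)
    qed
    ultimately have "inv w i < inv w (Suc i) \<longleftrightarrow>
        simple_refl j (inv w i) < simple_refl j (inv w (Suc i))"
      using simple_refl_mono[of "inv w i" "inv w (Suc i)" j]
        simple_refl_mono[of "inv w (Suc i)" "inv w i" j]
      by (auto simp: insert_commute neq_iff)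
    with * show ?thesis
      using assms by (auto simp: right_dem_def left_dem_def inv_comp_simple_refl comp_assoc)
  qed
qed

abbreviation left_word :: "nat list \<Rightarrow> (nat \<Rightarrow> nat) \<Rightarrow> nat \<Rightarrow> nat"
  where "left_word is \<equiv> foldr left_dem is"

abbreviation right_word :: "nat list \<Rightarrow> (nat \<Rightarrow> nat) \<Rightarrow> nat \<Rightarrow> nat"
  where "right_word js \<equiv> fold right_dem js"

lemma left_word_Sn: "w \<in> Sn n \<Longrightarrow> set is \<subseteq> {1..<n} \<Longrightarrow> left_word is w \<in> Sn n"
proof (induction "is")
  case (Cons i "is")
  then show ?case using left_dem_Sn[of "left_word is w" n i] by simp
qed simp

lemma left_dem_right_word:
  assumes "w \<in> Sn n" "set js \<subseteq> {1..<n}"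
  shows "left_dem i (right_word js w) = right_word js (left_dem i w)"
  using assms
proof (induction js arbitrary: w)
  case (Cons j js)
  have "bij w" using Cons by (auto intro: permutes_bij)
  with Cons show ?case using right_dem_Sn[of w n j] by (simp add: left_right_dem_commute)
qed simp

lemma left_right_word_commute:
  assumes "w \<in> Sn n" "set is \<subseteq> {1..<n}" "set js \<subseteq> {1..<n}"
  shows "left_word is (right_word js w) = right_word js (left_word is w)"
  using assms
proof (induction "is")
  case (Cons i "is")
  then show ?case using left_dem_right_word[OF left_word_Sn[of w n "is"], of js i] by simp
qed simp

lemma ex_right_word:
  assumes "w \<in> Sn n"
  shows "\<exists>js. set js \<subseteq> {1..<n} \<and> w = right_word js id"
  using assms
proof (induction "card (inversions w)" arbitrary: w rule: less_induct)
  case less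
  show ?case
  proof (cases "w = id")
    case True
    then show ?thesis by (intro exI[of _ "[]"]) simp
  next
    case False
    then obtain i where i: "i \<in> {1..<n}" "w (Suc i) < w i" using ex_descent less by blast
    let ?v = "w \<circ> simple_refl i"
    have v: "?v \<in> Sn n" using less i by (metis Sn_compose simple_refl_permutes)
    obtain js where js: "set js \<subseteq> {1..<n}" "?v = right_word js id"
      using less(1)[OF _ v] card_inversions_down[OF less(2) i(2,1)] by auto
    have "right_dem i ?v = w" using i by (simp add: right_dem_def fun_eq_iff)
    with js i show ?thesis by (intro exI[of _ "js @ [i]"]) simp
  qed
qed

lemma inv_right_dem:
  assumes "bij w" shows "inv (right_dem i w) = left_dem i (inv w)"
  using assms by (simp add: right_dem_def left_dem_def inv_comp_simple_refl inv_inv_eq)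

lemma inv_right_word:
  assumes "w \<in> Sn n" "set js \<subseteq> {1..<n}"
  shows "inv (right_word js w) = left_word (rev js) (inv w)"
  using assms
proof (induction js arbitrary: w)
  case (Cons j js)
  have "bij w" using Cons by (auto intro: permutes_bij)
  with Cons show ?case using right_dem_Sn[of w n j] by (simp add: inv_right_dem)
qed simp

lemma ex_left_word:
  assumes "w \<in> Sn n"
  shows "\<exists>is. set is \<subseteq> {1..<n} \<and> w = left_word is id"
proof -
  obtain js where js: "set js \<subseteq> {1..<n}" "inv w = right_word js id"
    using ex_right_word[OF Sn_inv[OF assms]] by blast
  have "w = inv (inv w)" using assms by (simp add: permutes_inv_inv)
  also have "\<dots> = left_word (rev js) id"
    unfolding js(2) using inv_right_word[OF Sn_id js(1)] by simp
  finally show ?thesis using js(1) by (intro exI[of _ "rev js"]) simp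
qed

text \<open>
  The product is defined by acting on the left with an arbitrary word of the first factor. As left
  and right operators commute, it can also be computed with any word of the second factor.
\<close>

lemma ex_demazure_product: "\<exists>f. is_demazure_product n f"
proof -
  define W where "W u = (SOME is. set is \<subseteq> {1..<n} \<and> u = left_word is id)" for u
  have W: "set (W u) \<subseteq> {1..<n}" "left_word (W u) id = u" if "u \<in> Sn n" for u
    using someI_ex[OF ex_left_word[OF that]] by (simp_all add: W_def)
  define f where "f u v = left_word (W u) v" for u v
  have right: "f u (right_word js id) = right_word js u" if "u \<in> Sn n" "set js \<subseteq> {1..<n}" for u js
    unfolding f_def using left_right_word_commute[OF Sn_id[of n] W(1)[OF that(1)] that(2)] W(2)[OF that(1)]
    by simp
  \<comment> \<open>Independence of the word chosen by \<open>W\<close>: once \<open>v\<close> is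
    written as a right word, the left actions can be moved past it onto \<open>id\<close>.\<close>
  have left: "f (left_word is id) v = left_word is v" if v: "v \<in> Sn n" and is': "set is \<subseteq> {1..<n}" for v "is"
  proof -
    obtain js where js: "set js \<subseteq> {1..<n}" "v = right_word js id" using ex_right_word[OF v] by blast
    show ?thesis
      using right[OF left_word_Sn[OF Sn_id is'] js(1)] left_right_word_commute[OF Sn_id is' js(1)] js(2)
      by simp
  qed
  have refl: "left_word [i] id = simple_refl i" "right_word [i] id = simple_refl i" for i
    by (simp_all add: left_dem_def right_dem_def)
  have "is_demazure_product n f"
    unfolding is_demazure_product_def
  proof (intro conjI ballI)
    show "f u v \<in> Sn n" if "u \<in> Sn n" "v \<in> Sn n" for u v
      unfolding f_def using left_word_Sn[OF that(2) W(1)[OF that(1)]] .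
    show "f (f u v) w = f u (f v w)" if "u \<in> Sn n" "v \<in> Sn n" "w \<in> Sn n" for u v w
    proof -
      obtain js where js: "set js \<subseteq> {1..<n}" "w = right_word js id"
        using ex_right_word[OF \<open>w \<in> Sn n\<close>] by blast
      have uv: "f u v \<in> Sn n" unfolding f_def using left_word_Sn[OF that(2) W(1)[OF that(1)]] .
      have "f (f u v) w = right_word js (left_word (W u) v)"
        using right[OF uv js(1)] js(2) by (simp add: f_def)
      also have "\<dots> = left_word (W u) (right_word js v)"
        using left_right_word_commute[OF that(2) W(1)[OF that(1)] js(1)] by simp
      also have "\<dots> = f u (f v w)"
        using right[OF that(2) js(1)] js(2) by (simp add: f_def)
      finally show ?thesis .
    qed
    show "f id id = id" using right[OF Sn_id, of "[]"] by simp
  next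
    fix g w assume "g \<in> simple_gens n" and w: "w \<in> Sn n"
    then obtain i where i: "i \<in> {1..<n}" "g = simple_refl i" by (auto simp: simple_gens_def)
    show "f g w = (if cox_length n (g \<circ> w) > cox_length n w then g \<circ> w else w)"
      using left[OF w, of "[i]"] refl(1)[of i] i cox_length_left[OF w i(1)] Sn_neq_Suc[OF Sn_inv[OF w], of i]
      by (auto simp: left_dem_def)
    show "f w g = (if cox_length n (w \<circ> g) > cox_length n w then w \<circ> g else w)"
      using right[OF w, of "[i]"] refl(2)[of i] i cox_length_right[OF w i(1)] Sn_neq_Suc[OF w, of i]
      by (auto simp: right_dem_def)
  qed
  then show ?thesis by blast
qed

lemma is_demazure_product_demazure: "is_demazure_product n (demazure n)"
  unfolding demazure_def using ex_demazure_product by (rule someI_ex)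

lemma demazure_Sn: "u \<in> Sn n \<Longrightarrow> v \<in> Sn n \<Longrightarrow> demazure n u v \<in> Sn n"
  using is_demazure_product_demazure unfolding is_demazure_product_def by blast

lemma demazure_assoc:
  "u \<in> Sn n \<Longrightarrow> v \<in> Sn n \<Longrightarrow> w \<in> Sn n \<Longrightarrow>
    demazure n (demazure n u v) w = demazure n u (demazure n v w)"
  using is_demazure_product_demazure unfolding is_demazure_product_def by blast

lemma demazure_id: "demazure n id id = id"
  using is_demazure_product_demazure unfolding is_demazure_product_def by blast

lemma demazure_simple_left:
  assumes "w \<in> Sn n" "i \<in> {1..<n}"
  shows "demazure n (simple_refl i) w = left_dem i w"
proof -
  have "demazure n (simple_refl i) w =
      (if cox_length n (simple_refl i \<circ> w) > cox_length n w then simple_refl i \<circ> w else w)"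
    using is_demazure_product_demazure[of n] assms
    unfolding is_demazure_product_def simple_gens_def by blast
  then show ?thesis
    using cox_length_left[OF assms] Sn_neq_Suc[OF Sn_inv[OF assms(1)], of i]
    by (cases "inv w i" "inv w (Suc i)" rule: linorder_cases) (simp_all add: left_dem_def)
qed

lemma demazure_simple_right:
  assumes "w \<in> Sn n" "i \<in> {1..<n}"
  shows "demazure n w (simple_refl i) = right_dem i w"
proof -
  have "demazure n w (simple_refl i) =
      (if cox_length n (w \<circ> simple_refl i) > cox_length n w then w \<circ> simple_refl i else w)"
    using is_demazure_product_demazure[of n] assms
    unfolding is_demazure_product_def simple_gens_def by blast
  then show ?thesis
    using cox_length_right[OF assms] Sn_neq_Suc[OF assms(1), of i]
    by (cases "w i" "w (Suc i)" rule: linorder_cases) (simp_all add: right_dem_def)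
qed

section \<open>Demazure squares and involutions\<close>

definition dem_sq :: "nat \<Rightarrow> (nat \<Rightarrow> nat) \<Rightarrow> nat \<Rightarrow> nat"
  where "dem_sq n u = demazure n u (inv u)"

text \<open>At a left ascent, \<open>simple_refl i \<circ> w\<close> and its inverse are Demazure
  products with the generator; associativity then leaves \<open>dem_sq n w\<close> in the
  middle.\<close>

lemma dem_sq_up_left:
  assumes "w \<in> Sn n" "i \<in> {1..<n}" "inv w i < inv w (Suc i)"
  shows "dem_sq n (simple_refl i \<circ> w) = left_dem i (right_dem i (dem_sq n w))"
proof -
  let ?s = "simple_refl i"
  have s: "?s \<in> Sn n" and iw: "inv w \<in> Sn n" and bw: "bij w"
    using simple_refl_permutes[OF assms(2)] Sn_inv[OF assms(1)] assms(1) permutes_bij by auto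
  have "?s \<circ> w = demazure n ?s w"
    using demazure_simple_left[OF assms(1,2)] assms(3) by (simp add: left_dem_def)
  moreover have "inv (?s \<circ> w) = demazure n (inv w) ?s"
    using demazure_simple_right[OF iw assms(2)] assms(3) bw
    by (simp add: right_dem_def inv_simple_refl_comp)
  ultimately have "dem_sq n (?s \<circ> w) = demazure n (demazure n ?s w) (demazure n (inv w) ?s)"
    by (simp add: dem_sq_def)
  also have "\<dots> = demazure n ?s (demazure n (dem_sq n w) ?s)"
    using s iw assms(1) by (simp add: dem_sq_def demazure_assoc demazure_Sn[simplified])
  also have "\<dots> = left_dem i (right_dem i (dem_sq n w))"
    using demazure_simple_left[OF right_dem_Sn[OF _ assms(2)] assms(2), of "dem_sq n w"]
      demazure_simple_right[OF _ assms(2), of "dem_sq n w"] demazure_Sn[OF assms(1) iw]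
    by (simp add: dem_sq_def)
  finally show ?thesis .
qed

text \<open>Here the two copies of the generator meet in the middle and merge, because a generator
  is idempotent for the Demazure product.\<close>

lemma dem_sq_up_right:
  assumes "w \<in> Sn n" "i \<in> {1..<n}" "w i < w (Suc i)"
  shows "dem_sq n (w \<circ> simple_refl i) = demazure n (demazure n w (simple_refl i)) (inv w)"
proof -
  let ?s = "simple_refl i"
  have s: "?s \<in> Sn n" and iw: "inv w \<in> Sn n" and bw: "bij w"
    using simple_refl_permutes[OF assms(2)] Sn_inv[OF assms(1)] assms(1) permutes_bij by auto
  have iiw: "inv (inv w) = w" using bw by (rule inv_inv_eq)
  have "w \<circ> ?s = demazure n w ?s"
    using demazure_simple_right[OF assms(1,2)] assms(3) by (simp add: right_dem_def)
  moreover have "inv (w \<circ> ?s) = demazure n ?s (inv w)"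
    using demazure_simple_left[OF iw assms(2)] assms(3) bw iiw
    by (simp add: left_dem_def inv_comp_simple_refl)
  ultimately have "dem_sq n (w \<circ> ?s) = demazure n (demazure n w ?s) (demazure n ?s (inv w))"
    by (simp add: dem_sq_def)
  also have "\<dots> = demazure n (demazure n w (demazure n ?s ?s)) (inv w)"
    using s iw assms(1) by (simp add: demazure_assoc demazure_Sn[simplified])
  also have "demazure n ?s ?s = ?s"
    using demazure_simple_right[OF s assms(2)] by (simp add: right_dem_def)
  finally show ?thesis .
qed

lemma braid:
  "simple_refl (Suc p) \<circ> simple_refl p \<circ> simple_refl (Suc p) =
   simple_refl p \<circ> simple_refl (Suc p) \<circ> simple_refl p"
  by (auto simp: fun_eq_iff simple_refl_def transpose_def)

text \<open>
  If \<open>v\<close> has the entries \<open>a < b < c\<close> at the positions \<open>p, p+1, p+2\<close>, then \<open>v \<circ> t \<circ> s\<close>, \<open>v \<circ> s \<circ> t\<close> and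
  \<open>v \<circ> t \<circ> s \<circ> t\<close> have \<open>c,a,b\<close>, \<open>b,c,a\<close> and \<open>c,b,a\<close> there. Each Demazure square is the Demazure
  product of \<open>v\<close>, the longest element \<open>s \<circ> t \<circ> s\<close> and the inverse of \<open>v\<close>.
\<close>

lemma dem_sq_three:
  fixes p :: nat
  defines "s \<equiv> simple_refl p" and "t \<equiv> simple_refl (Suc p)"
  assumes v: "v \<in> Sn n" and p: "1 \<le> p" "Suc (Suc p) \<le> n"
    and lt: "v p < v (Suc p)" "v (Suc p) < v (Suc (Suc p))"
  shows "dem_sq n (v \<circ> t \<circ> s) = dem_sq n (v \<circ> s \<circ> t)"
    and "dem_sq n (v \<circ> t \<circ> s \<circ> t) = dem_sq n (v \<circ> s \<circ> t)"
    and "cox_length n (v \<circ> t \<circ> s) = cox_length n (v \<circ> s \<circ> t)"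
    and "cox_length n (v \<circ> s \<circ> t) < cox_length n (v \<circ> t \<circ> s \<circ> t)"
proof -
  have i: "p \<in> {1..<n}" "Suc p \<in> {1..<n}" using p by auto
  have st: "s \<in> Sn n" "t \<in> Sn n" using i simple_refl_permutes unfolding s_def t_def by blast+
  have iv: "inv v \<in> Sn n" using v by (rule Sn_inv)
  have bv: "bij v" using v by (auto intro: permutes_bij)
  have vs: "v \<circ> s \<in> Sn n" and vt: "v \<circ> t \<in> Sn n" and ts: "t \<circ> s \<in> Sn n" and st': "s \<circ> t \<in> Sn n"
    and vts: "v \<circ> t \<circ> s \<in> Sn n"
    using v st Sn_compose by metis+
  have ev: "s p = Suc p" "s (Suc p) = p" "s (Suc (Suc p)) = Suc (Suc p)"
    "t p = p" "t (Suc p) = Suc (Suc p)" "t (Suc (Suc p)) = Suc p"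
    by (simp_all add: s_def t_def)
  have bvs: "bij (v \<circ> s)" "bij (v \<circ> t)" using vs vt by (auto intro: permutes_bij)
  have iiv: "inv (inv v) = v" using bv by (rule inv_inv_eq)
  note R = demazure_simple_right and L = demazure_simple_left
  have vt': "v \<circ> t = demazure n v t" using R[OF v i(2)] lt by (simp add: right_dem_def t_def)
  have vs': "v \<circ> s = demazure n v s" using R[OF v i(1)] lt by (simp add: right_dem_def s_def)
  have ivt: "inv (v \<circ> t) = demazure n t (inv v)"
    using L[OF iv i(2)] lt bv iiv by (simp add: left_dem_def t_def inv_comp_simple_refl)
  have ivs: "inv (v \<circ> s) = demazure n s (inv v)"
    using L[OF iv i(1)] lt bv iiv by (simp add: left_dem_def s_def inv_comp_simple_refl)
  have dts: "demazure n t s = t \<circ> s" using R[OF st(2) i(1)] ev by (simp add: right_dem_def s_def[symmetric])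
  have dst: "demazure n s t = s \<circ> t" using R[OF st(1) i(2)] ev by (simp add: right_dem_def t_def[symmetric])
  have dtst: "demazure n (t \<circ> s) t = s \<circ> t \<circ> s"
    using R[OF ts i(2)] ev braid[of p] by (simp add: right_dem_def t_def[symmetric] s_def[symmetric])
  have dsts: "demazure n (s \<circ> t) s = s \<circ> t \<circ> s"
    using R[OF st' i(1)] ev by (simp add: right_dem_def s_def[symmetric])
  \<comment> \<open>The longest element of the subgroup generated by \<open>s\<close> and
    \<open>t\<close>; it absorbs both generators by \<open>ms\<close> and \<open>mt\<close>.\<close>
  define m where "m = s \<circ> t \<circ> s"
  have m: "m \<in> Sn n" unfolding m_def using st st' Sn_compose by metis
  have evm: "m p = Suc (Suc p)" "m (Suc p) = Suc p" "m (Suc (Suc p)) = p" by (simp_all add: m_def ev)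
  have ms: "demazure n m s = m" using R[OF m i(1)] evm by (simp add: right_dem_def s_def[symmetric])
  have mt: "demazure n m t = m" using R[OF m i(2)] evm by (simp add: right_dem_def t_def[symmetric])
  have "dem_sq n (v \<circ> t \<circ> s) = demazure n (demazure n (demazure n v t) s) (demazure n t (inv v))"
    using dem_sq_up_right[OF vt i(1)] lt ev by (simp add: s_def[symmetric] ivt vt'[symmetric])
  also have "\<dots> = demazure n (demazure n v (demazure n (demazure n t s) t)) (inv v)"
    using v iv st by (simp add: demazure_assoc demazure_Sn[simplified])
  finally have 1: "dem_sq n (v \<circ> t \<circ> s) = demazure n (demazure n v m) (inv v)"
    by (simp add: dts dtst m_def)
  have "dem_sq n (v \<circ> s \<circ> t) = demazure n (demazure n (demazure n v s) t) (demazure n s (inv v))"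
    using dem_sq_up_right[OF vs i(2)] lt ev by (simp add: t_def[symmetric] ivs vs'[symmetric])
  also have "\<dots> = demazure n (demazure n v (demazure n (demazure n s t) s)) (inv v)"
    using v iv st by (simp add: demazure_assoc demazure_Sn[simplified])
  finally have 2: "dem_sq n (v \<circ> s \<circ> t) = demazure n (demazure n v m) (inv v)"
    by (simp add: dst dsts m_def)
  have vts': "v \<circ> t \<circ> s = demazure n (demazure n v t) s"
    using R[OF vt i(1)] lt ev by (simp add: right_dem_def s_def[symmetric] vt'[symmetric])
  have ivts: "inv (v \<circ> t \<circ> s) = demazure n s (demazure n t (inv v))"
  proof -
    have "inv (v \<circ> t \<circ> s) = s \<circ> inv (v \<circ> t)" using bvs by (simp add: s_def inv_comp_simple_refl)
    also have "\<dots> = demazure n s (inv (v \<circ> t))"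
      using L[OF Sn_inv[OF vt] i(1)] bvs lt ev by (simp add: left_dem_def s_def inv_inv_eq)
    finally show ?thesis by (simp add: ivt)
  qed
  have "dem_sq n (v \<circ> t \<circ> s \<circ> t) = demazure n (demazure n (v \<circ> t \<circ> s) t) (inv (v \<circ> t \<circ> s))"
    using dem_sq_up_right[OF vts i(2)] lt ev by (simp add: t_def[symmetric])
  also have "\<dots> = demazure n (demazure n (demazure n (demazure n v t) s) t)
      (demazure n s (demazure n t (inv v)))"
    by (simp only: vts'[symmetric] ivts)
  \<comment> \<open>The middle word is \<open>t s t s t\<close>: its first three letters give
    \<open>m\<close>, which absorbs the last two.\<close>
  also have "\<dots> = demazure n (demazure n v (demazure n (demazure n (demazure n (demazure n t s) t) s) t)) (inv v)"
    using v iv st by (simp add: demazure_assoc demazure_Sn[simplified])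
  finally have 3: "dem_sq n (v \<circ> t \<circ> s \<circ> t) = demazure n (demazure n v m) (inv v)"
    by (simp add: dts dtst m_def[symmetric] ms mt)
  show "dem_sq n (v \<circ> t \<circ> s) = dem_sq n (v \<circ> s \<circ> t)"
    and "dem_sq n (v \<circ> t \<circ> s \<circ> t) = dem_sq n (v \<circ> s \<circ> t)" using 1 2 3 by simp_all
  show "cox_length n (v \<circ> t \<circ> s) = cox_length n (v \<circ> s \<circ> t)"
    and "cox_length n (v \<circ> s \<circ> t) < cox_length n (v \<circ> t \<circ> s \<circ> t)"
    using cox_length_right(1)[OF v i(1)] cox_length_right(1)[OF v i(2)]
      cox_length_right(1)[OF vs i(2)] cox_length_right(1)[OF vt i(1)]
      cox_length_right(1)[OF vts i(2)] lt ev
    by (simp_all add: s_def[symmetric] t_def[symmetric])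
qed

text \<open>One step down among involutions at a descent \<open>i\<close>. Normally this is
  conjugation; if \<open>i\<close> and \<open>Suc i\<close> form a two-cycle, conjugation would
  return \<open>x\<close>, so the two-cycle is removed instead.\<close>

definition lower_invol :: "nat \<Rightarrow> (nat \<Rightarrow> nat) \<Rightarrow> nat \<Rightarrow> nat"
  where "lower_invol i x =
    (if x i = Suc i then simple_refl i \<circ> x else simple_refl i \<circ> x \<circ> simple_refl i)"

lemma lower_invol:
  assumes x: "x \<in> Sn n" "x \<circ> x = id" and i: "i \<in> {1..<n}" and desc: "x (Suc i) < x i"
  shows "lower_invol i x \<in> Sn n" and "lower_invol i x \<circ> lower_invol i x = id"
    and "cox_length n (lower_invol i x) < cox_length n x"
    and "left_dem i (right_dem i (lower_invol i x)) = x"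
    and "lower_invol i x i < lower_invol i x (Suc i)"
proof -
  let ?s = "simple_refl i" and ?y = "lower_invol i x"
  have s: "?s \<in> Sn n" using i by (rule simple_refl_permutes)
  show "?y \<in> Sn n" unfolding lower_invol_def using s x Sn_compose by metis
  have xx: "x (x p) = p" for p using x(2) by (simp add: fun_eq_iff)
  have xeq: "x p = x q \<longleftrightarrow> p = q" for p q using xx by metis
  have invx: "inv x = x" using x(2) by (metis inv_unique_comp)
  have bx: "bij x" using x by (auto intro: permutes_bij)
  have "?y \<circ> ?y = id \<and> cox_length n ?y < cox_length n x \<and> left_dem i (right_dem i ?y) = x
    \<and> ?y i < ?y (Suc i)"
  proof (cases "x i = Suc i")
    case True
    then have xS: "x (Suc i) = i" using xx by metis
    have other: "p \<noteq> i \<Longrightarrow> p \<noteq> Suc i \<Longrightarrow> x p \<noteq> i \<and> x p \<noteq> Suc i" for p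
      using True xS xeq by metis
    have y: "?y = ?s \<circ> x" using True by (simp add: lower_invol_def)
    have c: "?s \<circ> x = x \<circ> ?s"
    proof
      fix p show "(?s \<circ> x) p = (x \<circ> ?s) p"
        using True xS other[of p] by (cases "p = i"; cases "p = Suc i") auto
    qed
    have "?y \<circ> ?y = id" unfolding y by (subst c) (simp add: fun_eq_iff xx)
    moreover have "cox_length n ?y < cox_length n x"
      unfolding y c using cox_length_right(2)[OF x(1) i desc] by simp
    moreover have "right_dem i ?y = x"
      unfolding y c using True xS by (simp add: right_dem_def)
    moreover have "left_dem i x = x" using desc by (simp add: left_dem_def invx)
    ultimately show ?thesis using True xS y by simp
  next
    case False
    then have y: "?y = ?s \<circ> x \<circ> ?s" by (simp add: lower_invol_def)
    \<comment> \<open>The pair of values is not \<open>(i, Suc i)\<close>, so its comparison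
      survives the left swap. Hence conjugation shortens \<open>x\<close> twice, and both Demazure
      operators act when restoring it.\<close>
    have lt: "?s (x (Suc i)) < ?s (x i)" using False desc by (intro simple_refl_mono) auto
    have xs: "x \<circ> ?s \<in> Sn n" using x s Sn_compose by metis
    have "?y \<circ> ?y = id" unfolding y by (simp add: fun_eq_iff xx)
    moreover have "cox_length n ?y < cox_length n x"
      using cox_length_right(2)[OF x(1) i desc] cox_length_left(2)[OF xs i] lt bx
      by (simp add: y comp_assoc inv_comp_simple_refl invx)
    moreover have "right_dem i ?y = ?s \<circ> x" using lt by (simp add: y right_dem_def)
    moreover have "left_dem i (?s \<circ> x) = x"
      using desc bx by (simp add: left_dem_def inv_simple_refl_comp invx)
    ultimately show ?thesis using lt y by simp
  qed
  then show "?y \<circ> ?y = id" "cox_length n ?y < cox_length n x" "left_dem i (right_dem i ?y) = x"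
    "?y i < ?y (Suc i)" by blast+
qed

text \<open>Guarantees that inverse atoms exist. A preimage of the lowered involution, multiplied on
  the left by the generator, is a preimage of \<open>x\<close>.\<close>

lemma ex_dem_sq:
  assumes "x \<in> Sn n" "x \<circ> x = id"
  shows "\<exists>u\<in>Sn n. dem_sq n u = x"
  using assms
proof (induction "cox_length n x" arbitrary: x rule: less_induct)
  case less
  show ?case
  proof (cases "x = id")
    case True
    then show ?thesis using Sn_id demazure_id[of n] by (intro bexI[of _ id]) (simp_all add: dem_sq_def)
  next
    case False
    then obtain i where i: "i \<in> {1..<n}" "x (Suc i) < x i" using ex_descent less by blast
    note low = lower_invol[OF less(2,3) i]
    let ?y = "lower_invol i x"
    obtain u where u: "u \<in> Sn n" "dem_sq n u = ?y" using less(1)[OF low(3,1,2)] by blast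
    have s: "simple_refl i \<in> Sn n" using i(1) by (rule simple_refl_permutes)
    \<comment> \<open>Otherwise the generator would be absorbed by \<open>u\<close>, hence by its
      Demazure square \<open>?y\<close>, whereas \<open>?y\<close> has an ascent at
      \<open>i\<close>.\<close>
    have "inv u i < inv u (Suc i)"
    proof (rule ccontr)
      assume "\<not> ?thesis"
      then have "demazure n (simple_refl i) u = u"
        using demazure_simple_left[OF u(1) i(1)] by (simp add: left_dem_def)
      then have "demazure n (simple_refl i) (dem_sq n u) = dem_sq n u"
        using demazure_assoc[OF s u(1) Sn_inv[OF u(1)]] by (simp add: dem_sq_def)
      then have "left_dem i ?y = ?y" using demazure_simple_left[OF low(1) i(1)] u(2) by simp
      moreover have "inv ?y = ?y" using low(2) by (metis inv_unique_comp)
      ultimately have "simple_refl i \<circ> ?y = ?y" using low(5) by (simp add: left_dem_def)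
      then have "simple_refl i (?y (?y i)) = ?y (?y i)" by (metis comp_apply)
      moreover have "?y (?y i) = i" using low(2) by (simp add: fun_eq_iff)
      ultimately show False by simp
    qed
    then have "dem_sq n (simple_refl i \<circ> u) = x"
      using dem_sq_up_left[OF u(1) i(1)] u(2) low(4) by simp
    then show ?thesis using Sn_compose[OF s u(1)] by blast
  qed
qed

subsection \<open>Words made of the cycles of an involution\<close>

text \<open>
  In the one-line word of \<^term>\<open>u\<close> every two-cycle \<open>a < b\<close> occurs as the factor \<open>b a\<close>, and these
  factors and the fixed points are in an order compatible with the product order on the cycles. Both
  \<^const>\<open>hat0\<close> and \<^const>\<open>hat1\<close> are of this kind.
\<close>

definition cycle_aligned :: "(nat \<Rightarrow> nat) \<Rightarrow> (nat \<Rightarrow> nat) \<Rightarrow> bool"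
  where "cycle_aligned y u \<longleftrightarrow>
    (\<forall>a. a < y a \<longrightarrow> inv u a = Suc (inv u (y a))) \<and>
    (\<forall>a b. a \<le> y a \<longrightarrow> b \<le> y b \<longrightarrow> a < b \<longrightarrow> y a < y b \<longrightarrow> inv u a < inv u b)"

text \<open>If \<open>y\<close> increased at \<open>i\<close>, the cycle of \<open>i\<close> would
  be below the cycle of \<open>Suc i\<close> in both coordinates and come first in \<open>u\<close>.
  The cases say which end of its cycle each of the two is; a larger end stands just before its
  smaller end.\<close>

lemma cycle_aligned_descent:
  assumes y: "y \<in> Sn n" "y \<circ> y = id" and al: "cycle_aligned y u"
    and desc: "inv u (Suc i) < inv u i"
  shows "y (Suc i) < y i"
proof (rule ccontr)
  assume "\<not> ?thesis"
  with Sn_neq_Suc[OF y(1), of i] have lt: "y i < y (Suc i)" by auto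
  have yy: "y (y p) = p" for p using y(2) by (simp add: fun_eq_iff)
  have adj: "inv u (y b) = Suc (inv u b)" if "y b < b" for b
    using al that yy unfolding cycle_aligned_def by metis
  have ord: "inv u a < inv u b" if "a \<le> y a" "b \<le> y b" "a < b" "y a < y b" for a b
    using al that unfolding cycle_aligned_def by blast
  consider "i \<le> y i" "Suc i \<le> y (Suc i)" | "i \<le> y i" "y (Suc i) < Suc i"
    | "y i < i" "Suc i \<le> y (Suc i)" | "y i < i" "y (Suc i) < Suc i" by linarith
  then show False
  proof cases
    case 1
    then show ?thesis using ord[of i "Suc i"] lt desc by simp
  next
    case 2
    then show ?thesis using lt by simp
  next
    case 3
    then show ?thesis using ord[of "y i" "Suc i"] adj[of i] desc by (simp add: yy)
  next
    case 4
    then show ?thesis using ord[of "y i" "y (Suc i)"] adj[of i] adj[of "Suc i"] lt desc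
      by (simp add: yy)
  qed
qed

text \<open>The generator renames \<open>i\<close> and \<open>Suc i\<close> in the word, and the
  cycles are renamed alike or the two-cycle splits. Only comparisons of \<open>i\<close> with
  \<open>Suc i\<close> are affected, and the descent settles those.\<close>

lemma cycle_aligned_lower:
  assumes y: "y \<in> Sn n" "y \<circ> y = id" and u: "u \<in> Sn n" and al: "cycle_aligned y u"
    and desc: "inv u (Suc i) < inv u i"
  shows "cycle_aligned (lower_invol i y) (simple_refl i \<circ> u)"
proof -
  let ?s = "simple_refl i" and ?P = "inv u"
  have bu: "bij u" using u by (auto intro: permutes_bij)
  have yy: "y (y p) = p" for p using y(2) by (simp add: fun_eq_iff)
  have yeq: "y p = y q \<longleftrightarrow> p = q" for p q using yy by metis
  have Peq: "?P p = ?P q \<longleftrightarrow> p = q" for p q using bu by (metis bij_imp_bij_inv bij_is_inj inj_eq)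
  have adj: "?P a = Suc (?P (y a))" if "a < y a" for a
    using al that unfolding cycle_aligned_def by blast
  have ord: "?P a < ?P b" if "a \<le> y a" "b \<le> y b" "a < b" "y a < y b" for a b
    using al that unfolding cycle_aligned_def by blast
  have sless: "a < b" if "?s a < ?s b" "(a, b) \<noteq> (Suc i, i)" for a b
  proof -
    have "(?s a, ?s b) \<noteq> (i, Suc i)"
      using that(2) by (metis simple_refl_involutory(1) simple_refl_simps(1,2) prod.inject)
    then show ?thesis using simple_refl_mono[OF that(1), of i] by simp
  qed
  have P': "inv (?s \<circ> u) p = ?P (?s p)" for p using bu by (simp add: inv_simple_refl_comp)
  show ?thesis
  proof (cases "y i = Suc i")
    case True
    then have yS: "y (Suc i) = i" using yy by metis
    have other: "y p \<noteq> i \<and> y p \<noteq> Suc i" if "p \<noteq> i" "p \<noteq> Suc i" for p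
      using that True yS yeq by metis
    \<comment> \<open>The factor \<open>Suc i\<close>, \<open>i\<close> of the word becomes two
      adjacent fixed points in increasing order.\<close>
    have Pi: "?P i = Suc (?P (Suc i))" using adj[of i] True by simp
    have l: "lower_invol i y p = (if p = i \<or> p = Suc i then p else y p)" for p
      using True yS other[of p] by (auto simp: lower_invol_def)
    have fix1: "?P (?s a) < ?P (?s b)"
      if "a \<le> lower_invol i y a" "b \<le> lower_invol i y b" "a < b" "lower_invol i y a < lower_invol i y b" for a b
    proof -
      consider "a \<in> {i, Suc i}" "b \<in> {i, Suc i}" | "a \<in> {i, Suc i}" "b \<notin> {i, Suc i}"
        | "a \<notin> {i, Suc i}" "b \<in> {i, Suc i}" | "a \<notin> {i, Suc i}" "b \<notin> {i, Suc i}" by blast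
      then show ?thesis
      proof cases
        case 1
        with that(3) have "a = i" "b = Suc i" by auto
        then show ?thesis using desc by simp
      next
        case 2
        then have "?P i < ?P b" using that other[of b] True by (intro ord) (auto simp: l)
        moreover have "?P (?s a) \<le> ?P i" using 2 Pi by auto
        ultimately show ?thesis using 2 by simp
      next
        case 3
        then have "?P a < ?P i" using that other[of a] True by (intro ord) (auto simp: l)
        \<comment> \<open>Since \<open>Suc i\<close> stands directly before \<open>i\<close>, any
          other entry before \<open>i\<close> is before both.\<close>
        then have "?P a < ?P (Suc i)" using Pi Peq[of a "Suc i"] 3 by (auto simp: less_Suc_eq)
        then show ?thesis using 3 Pi by auto
      next
        case 4
        then show ?thesis using that ord[of a b] by (simp add: l)
      qed
    qed
    have "?P (?s a) = Suc (?P (?s (lower_invol i y a)))" if "a < lower_invol i y a" for a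
      using that other[of a] adj[of a] by (auto simp: l split: if_splits)
    with fix1 show ?thesis unfolding cycle_aligned_def P' by blast
  next
    case False
    then have l: "lower_invol i y (?s p) = ?s (y p)" for p by (simp add: lower_invol_def)
    \<comment> \<open>Rules out the exceptional pair of \<open>sless\<close> inside a single cycle;
      it can only arise between different cycles.\<close>
    have no: "(p, y p) \<noteq> (Suc i, i)" for p using False yy by (metis prod.inject)
    have A: "?P p = Suc (?P (y p))" if "?s p < ?s (y p)" for p
      using adj[of p] sless[OF that no] by simp
    have le: "p \<le> y p" if "?s p \<le> ?s (y p)" for p
      using that sless[OF _ no, of p] by (cases "p = y p") (auto simp: le_less)
    have B: "?P p < ?P q"
      if "?s p \<le> ?s (y p)" "?s q \<le> ?s (y q)" "?s p < ?s q" "?s (y p) < ?s (y q)" for p q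
    proof -
      note pq = le[OF that(1)] le[OF that(2)]
      consider "(p, q) = (Suc i, i)" | "(y p, y q) = (Suc i, i)"
        | "(p, q) \<noteq> (Suc i, i)" "(y p, y q) \<noteq> (Suc i, i)" by blast
      then show ?thesis
      proof cases
        case 1
        then show ?thesis using desc by simp
      next
        case 2
        \<comment> \<open>The larger ends are \<open>Suc i\<close> and \<open>i\<close>, ordered in
          the word by the descent; each smaller end is at most one place later, so the smaller ends
          have the same order.\<close>
        then have "?P (y p) < ?P (y q)" using desc by simp
        moreover have "?P p \<le> Suc (?P (y p))" using adj[of p] pq by (cases "p = y p") auto
        moreover have "?P (y q) \<le> ?P q" using adj[of q] pq by (cases "q = y q") auto
        moreover have "?P p \<noteq> ?P q" using that(3) Peq by auto
        ultimately show ?thesis by linarith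
      next
        case 3
        then show ?thesis using ord[OF pq] sless that by blast
      qed
    qed
    have A': "?P (?s a) = Suc (?P (?s (lower_invol i y a)))" if "a < lower_invol i y a" for a
      using A[of "?s a"] l[of "?s a"] that by simp
    have B': "?P (?s a) < ?P (?s b)"
      if "a \<le> lower_invol i y a" "b \<le> lower_invol i y b" "a < b" "lower_invol i y a < lower_invol i y b" for a b
      using B[of "?s a" "?s b"] l[of "?s a"] l[of "?s b"] that by simp
    show ?thesis unfolding cycle_aligned_def P' using A' B' by blast
  qed
qed

text \<open>A left descent of \<open>u\<close> is a descent of \<open>y\<close>, and lowering both
  preserves alignment; by \<open>dem_sq_up_left\<close> and \<open>lower_invol\<close> the generator
  then restores both sides.\<close>

lemma dem_sq_cycle_aligned:
  assumes "u \<in> Sn n" "y \<in> Sn n" "y \<circ> y = id" "cycle_aligned y u"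
  shows "dem_sq n u = y"
  using assms
proof (induction "cox_length n u" arbitrary: u y rule: less_induct)
  case less
  have yy: "y (y p) = p" for p using less.prems(3) by (simp add: fun_eq_iff)
  show ?case
  proof (cases "u = id")
    case True
    \<comment> \<open>In the identity word no larger entry stands directly before a smaller
      one.\<close>
    have "\<not> a < y a" for a
    proof
      assume "a < y a"
      then have "inv u a = Suc (inv u (y a))" using less.prems(4) unfolding cycle_aligned_def by blast
      then show False using \<open>a < y a\<close> True by simp
    qed
    then have "y a \<le> a" for a by (simp add: not_less)
    then have "y a = a" for a using yy by (metis order_antisym)
    then have "y = id" by (simp add: fun_eq_iff)
    then show ?thesis using True demazure_id[of n] by (simp add: dem_sq_def)
  next
    case False
    have iu: "inv u \<in> Sn n" using less.prems(1) by (rule Sn_inv)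
    have "inv u \<noteq> id"
    proof
      assume "inv u = id"
      then have "inv (inv u) = id" by simp
      then show False using False less.prems(1) by (simp add: permutes_inv_inv)
    qed
    then obtain i where i: "i \<in> {1..<n}" and desc: "inv u (Suc i) < inv u i"
      using ex_descent[OF iu] by blast
    have s: "simple_refl i \<in> Sn n" using i(1) by (rule simple_refl_permutes)
    let ?v = "simple_refl i \<circ> u" and ?y = "lower_invol i y"
    have v: "?v \<in> Sn n" using s less.prems(1) Sn_compose by blast
    have dy: "y (Suc i) < y i" using cycle_aligned_descent less.prems desc by blast
    note low = lower_invol[OF less.prems(2,3) i dy]
    have "cox_length n ?v < cox_length n u" using cox_length_left(2)[OF less.prems(1) i desc] by simp
    moreover have "cycle_aligned ?y ?v"
      using cycle_aligned_lower[OF less.prems(2,3,1,4) desc] .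
    ultimately have IH: "dem_sq n ?v = ?y" using less.hyps v low(1,2) by blast
    have "inv ?v i < inv ?v (Suc i)"
      using desc less.prems(1) by (simp add: inv_simple_refl_comp permutes_bij)
    from dem_sq_up_left[OF v i this] show ?thesis by (simp add: IH low(4))
  qed
qed

section \<open>Words and involutions given by a list of cycles\<close>

definition cycle_word :: "(nat \<times> nat) list \<Rightarrow> nat list"
  where "cycle_word L = concat (map (\<lambda>(a, b). if a = b then [a] else [b, a]) L)"

lemma cycle_word_simps [simp]:
  "cycle_word [] = []"
  "cycle_word ((a, b) # L) = (if a = b then [a] else [b, a]) @ cycle_word L"
  "cycle_word (L @ M) = cycle_word L @ cycle_word M"
  by (simp_all add: cycle_word_def)

lemma in_set_cycle_word: "z \<in> set (cycle_word L) \<longleftrightarrow> (\<exists>(a, b)\<in>set L. z = a \<or> z = b)"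
  by (induction L) (auto split: if_splits)

text \<open>A fixed point is listed as \<open>(a, a)\<close> and contributes the identity.\<close>

definition cycle_invol :: "(nat \<times> nat) list \<Rightarrow> nat \<Rightarrow> nat"
  where "cycle_invol L = foldr (\<lambda>(a, b) g. Transposition.transpose a b \<circ> g) L id"

lemma cycle_invol_fixed: "z \<notin> set (cycle_word L) \<Longrightarrow> cycle_invol L z = z"
  by (induction L) (auto simp: cycle_invol_def split: if_splits)

lemma cycle_invol_swap:
  assumes "distinct (cycle_word L)" "(a, b) \<in> set L"
  shows "cycle_invol L a = b \<and> cycle_invol L b = a"
  using assms
proof (induction L)
  case (Cons z L)
  obtain c d where z: "z = (c, d)" by fastforce
  have step: "cycle_invol (z # L) p = Transposition.transpose c d (cycle_invol L p)" for p
    by (simp add: cycle_invol_def z)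
  have dist: "distinct (cycle_word L)" "c \<notin> set (cycle_word L)" "d \<notin> set (cycle_word L)"
    using Cons.prems(1) by (auto simp: z split: if_splits)
  show ?case
  proof (cases "(a, b) \<in> set L")
    case True
    then have "a \<in> set (cycle_word L)" "b \<in> set (cycle_word L)"
      by (auto simp: in_set_cycle_word)
    then have "a \<noteq> c" "a \<noteq> d" "b \<noteq> c" "b \<noteq> d" using dist by auto
    then show ?thesis using Cons.IH[OF dist(1) True] by (simp add: step)
  next
    case False
    then have "a = c" "b = d" using Cons.prems(2) z by auto
    then show ?thesis using cycle_invol_fixed[OF dist(2)] cycle_invol_fixed[OF dist(3)]
      by (simp add: step)
  qed
qed simp

lemma cycle_invol_invol:
  assumes "distinct (cycle_word L)"
  shows "cycle_invol L \<circ> cycle_invol L = id"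
proof
  fix z show "(cycle_invol L \<circ> cycle_invol L) z = id z"
  proof (cases "z \<in> set (cycle_word L)")
    case True
    then obtain a b where ab: "(a, b) \<in> set L" "z = a \<or> z = b" by (auto simp: in_set_cycle_word)
    then show ?thesis using cycle_invol_swap[OF assms ab(1)] by auto
  next
    case False
    then show ?thesis by (simp add: cycle_invol_fixed)
  qed
qed

lemma cycle_invol_permutes: "set (cycle_word L) \<subseteq> S \<Longrightarrow> cycle_invol L permutes S"
proof (induction L)
  case Nil
  have "cycle_invol [] = id" by (simp add: cycle_invol_def)
  then show ?case by (simp only: permutes_id)
next
  case (Cons z L)
  obtain c d where z: "z = (c, d)" by fastforce
  have "cycle_invol (z # L) = Transposition.transpose c d \<circ> cycle_invol L"
    by (simp add: cycle_invol_def z)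
  moreover have "cycle_invol L permutes S" "c \<in> S" "d \<in> S"
    using Cons by (auto simp: z split: if_splits)
  ultimately show ?case by (metis permutes_compose permutes_swap_id)
qed

text \<open>Recovers the listed cycles, so that \<open>hat0\<close> and \<open>hat1\<close> of this
  involution are found by sorting the entries of \<open>L\<close>.\<close>

lemma Cyc_cycle_invol:
  assumes "distinct (cycle_word L)" "set (cycle_word L) = {1..n}" "\<forall>(a, b)\<in>set L. a \<le> b"
  shows "Cyc n (cycle_invol L) = set L"
proof (intro equalityI subsetI)
  fix z assume "z \<in> Cyc n (cycle_invol L)"
  then obtain p where p: "z = (p, cycle_invol L p)" "p \<in> {1..n}" "p \<le> cycle_invol L p"
    by (auto simp: Cyc_def)
  then obtain a b where ab: "(a, b) \<in> set L" "p = a \<or> p = b"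
    using assms(2) in_set_cycle_word[of p L] by auto
  then have "a \<le> b" using assms(3) by auto
  then show "z \<in> set L" using cycle_invol_swap[OF assms(1) ab(1)] ab p by auto
next
  fix z assume z: "z \<in> set L"
  obtain a b where ab: "z = (a, b)" by fastforce
  have "a \<in> set (cycle_word L)" "b \<in> set (cycle_word L)" using z ab by (auto simp: in_set_cycle_word)
  then show "z \<in> Cyc n (cycle_invol L)"
    using cycle_invol_swap[OF assms(1), of a b] z ab assms(2,3) by (auto simp: Cyc_def)
qed

lemma remdups_keep_first_append:
  assumes "set xs \<inter> set ys = {}"
  shows "remdups_keep_first (xs @ ys) = remdups_keep_first xs @ remdups_keep_first ys"
proof -
  have "remdups (us @ vs) = remdups us @ remdups vs" if "set us \<inter> set vs = {}" for us vs :: "'a list"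
    using that by (induction us) auto
  then show ?thesis using assms by (simp add: remdups_keep_first_def Int_commute)
qed

text \<open>Different cycles share no entries, so the only repetition to delete is the second copy
  of a fixed point.\<close>

lemma remdups_keep_first_cycles:
  "distinct (cycle_word L) \<Longrightarrow>
    remdups_keep_first (concat (map (\<lambda>(a, b). [b, a]) L)) = cycle_word L"
proof (induction L)
  case Nil
  show ?case by (simp add: remdups_keep_first_def)
next
  case (Cons z L)
  obtain c d where z: "z = (c, d)" by fastforce
  have "set (concat (map (\<lambda>(a, b). [b, a]) L)) = set (cycle_word L)"
    by (fastforce simp: in_set_cycle_word)
  then have "set [d, c] \<inter> set (concat (map (\<lambda>(a, b). [b, a]) L)) = {}"
    using Cons.prems by (auto simp: z split: if_splits)
  from remdups_keep_first_append[OF this] Cons show ?case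
    by (auto simp: z remdups_keep_first_def split: if_splits)
qed

text \<open>Strictly increasing keys make \<open>f\<close> injective on the set, and then only one
  sorted listing exists.\<close>

lemma (in linorder) sorted_key_list_of_set_strict:
  assumes "sorted_wrt (<) (map f xs)"
  shows "sorted_key_list_of_set f (set xs) = xs"
proof -
  have d: "distinct (map f xs)" "sorted (map f xs)" using assms by (simp_all add: strict_sorted_iff)
  interpret folding_insort_key "(\<le>)" "(<)" "set xs" f
    by unfold_locales (use d in \<open>simp add: distinct_map\<close>)
  show ?thesis
    using idem_if_sorted_distinct[of xs] d by (auto simp: distinct_map)
qed

lemma hat0_cycle_invol:
  assumes "distinct (cycle_word L)" "set (cycle_word L) = {1..n}" "\<forall>(a, b)\<in>set L. a \<le> b"
    and "sorted_wrt (<) (map fst L)"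
  shows "hat0 n (cycle_invol L) = cycle_word L"
  by (simp only: hat0_def Cyc_cycle_invol[OF assms(1-3)] sorted_key_list_of_set_strict[OF assms(4)]
      remdups_keep_first_cycles[OF assms(1)])

lemma hat1_cycle_invol:
  assumes "distinct (cycle_word L)" "set (cycle_word L) = {1..n}" "\<forall>(a, b)\<in>set L. a \<le> b"
    and "sorted_wrt (<) (map snd L)"
  shows "hat1 n (cycle_invol L) = cycle_word L"
  by (simp only: hat1_def Cyc_cycle_invol[OF assms(1-3)] sorted_key_list_of_set_strict[OF assms(4)]
      remdups_keep_first_cycles[OF assms(1)])

text \<open>The word is cut from the left: an ascent makes its first entry a fixed point, a descent
  forms a two-cycle. The extra entry \<open>m\<close> is the last entry of the preceding block, or a
  lower bound at the start; the hypothesis on \<open>m # xs\<close> keeps the smaller ends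
  increasing.\<close>

lemma avoiding_imp_cycle_word_fst:
  fixes xs :: "nat list"
  assumes "distinct xs" "\<And>us p q r vs. m # xs = us @ [p, q, r] @ vs \<Longrightarrow> r < q \<Longrightarrow> p < r"
    and "xs \<noteq> [] \<Longrightarrow> m < hd xs"
  shows "\<exists>L. xs = cycle_word L \<and> sorted_wrt (<) (m # map fst L) \<and> (\<forall>(a, b)\<in>set L. a \<le> b)"
  using assms
proof (induction "length xs" arbitrary: m xs rule: less_induct)
  case less
  note avoid = less.prems(2)
  consider "xs = []" | q where "xs = [q]" | q r zs where "xs = q # r # zs"
    by (metis list.exhaust)
  then show ?case
  proof cases
    case 1
    then show ?thesis by (intro exI[of _ "[]"]) simp
  next
    case 2
    then show ?thesis using less.prems(3) by (intro exI[of _ "[(q, q)]"]) simp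
  next
    case (3 q r zs)
    have mq: "m < q" using less.prems(3) 3 by simp
    show ?thesis
    proof (cases "q < r")
      case True
      have "\<exists>L. r # zs = cycle_word L \<and> sorted_wrt (<) (q # map fst L) \<and> (\<forall>(a, b)\<in>set L. a \<le> b)"
      proof (rule less.hyps)
        show "p' < r'" if "q # r # zs = us @ [p', q', r'] @ vs" "r' < q'" for us p' q' r' vs
          using avoid[of "m # us" p' q' r' vs] that 3 by simp
      qed (use 3 less.prems(1) True in auto)
      then obtain L where "r # zs = cycle_word L" "sorted_wrt (<) (q # map fst L)"
          "\<forall>(a, b)\<in>set L. a \<le> b" by blast
      then show ?thesis using 3 mq by (intro exI[of _ "(q, q) # L"]) auto
    next
      case False
      then have rq: "r < q" using less.prems(1) 3 by auto
      have mr: "m < r" using avoid[of "[]" m q r zs] rq 3 by simp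
      have "\<exists>L. zs = cycle_word L \<and> sorted_wrt (<) (r # map fst L) \<and> (\<forall>(a, b)\<in>set L. a \<le> b)"
      proof (rule less.hyps)
        show "p' < r'" if "r # zs = us @ [p', q', r'] @ vs" "r' < q'" for us p' q' r' vs
          using avoid[of "m # q # us" p' q' r' vs] that 3 by simp
        \<comment> \<open>After two descents \<open>q\<close>, \<open>r\<close>,
          \<open>hd zs\<close> in a row the hypothesis would demand
          \<open>q < hd zs\<close>.\<close>
        show "r < hd zs" if "zs \<noteq> []"
        proof (rule ccontr)
          assume "\<not> r < hd zs"
          then have "hd zs < r" using less.prems(1) 3 that by (cases zs) auto
          then have "q < hd zs" using avoid[of "[m]" q r "hd zs" "tl zs"] that 3 by simp
          with \<open>hd zs < r\<close> rq show False by simp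
        qed
      qed (use 3 less.prems(1) in auto)
      then obtain L where "zs = cycle_word L" "sorted_wrt (<) (r # map fst L)"
          "\<forall>(a, b)\<in>set L. a \<le> b" by blast
      then show ?thesis using 3 mr rq by (intro exI[of _ "(r, q) # L"]) auto
    qed
  qed
qed

text \<open>Every block starts with its larger end, and after a descent the next entry exceeds that
  end, so the larger ends increase. The last conjunct records the first larger end for comparison
  with the block before it.\<close>

lemma avoiding_imp_cycle_word_snd:
  fixes xs :: "nat list"
  assumes "distinct xs" "\<And>us p q r vs. xs = us @ [p, q, r] @ vs \<Longrightarrow> q < p \<Longrightarrow> p < r"
  shows "\<exists>L. xs = cycle_word L \<and> sorted_wrt (<) (map snd L) \<and> (\<forall>(a, b)\<in>set L. a \<le> b)
    \<and> (L \<noteq> [] \<longrightarrow> snd (hd L) = hd xs)"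
  using assms
proof (induction "length xs" arbitrary: xs rule: less_induct)
  case less
  note avoid = less.prems(2)
  have cons: "sorted_wrt (<) (map snd ((a, b) # L))"
    if "sorted_wrt (<) (map snd L)" "L \<noteq> [] \<Longrightarrow> b < snd (hd L)" for a b and L :: "(nat \<times> nat) list"
    using that by (cases L) auto
  consider "xs = []" | q where "xs = [q]" | q r zs where "xs = q # r # zs"
    by (metis list.exhaust)
  then show ?case
  proof cases
    case 1
    then show ?thesis by (intro exI[of _ "[]"]) simp
  next
    case 2
    then show ?thesis by (intro exI[of _ "[(q, q)]"]) simp
  next
    case (3 q r zs)
    show ?thesis
    proof (cases "q < r")
      case True
      have "\<exists>L. r # zs = cycle_word L \<and> sorted_wrt (<) (map snd L) \<and> (\<forall>(a, b)\<in>set L. a \<le> b)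
          \<and> (L \<noteq> [] \<longrightarrow> snd (hd L) = hd (r # zs))"
      proof (rule less.hyps)
        show "p' < r'" if "r # zs = us @ [p', q', r'] @ vs" "q' < p'" for us p' q' r' vs
          using avoid[of "q # us" p' q' r' vs] that 3 by simp
      qed (use 3 less.prems(1) in auto)
      then obtain L where L: "r # zs = cycle_word L" "sorted_wrt (<) (map snd L)"
          "\<forall>(a, b)\<in>set L. a \<le> b" "L \<noteq> [] \<longrightarrow> snd (hd L) = r" by auto
      then show ?thesis using 3 True cons[OF L(2), of q q] by (intro exI[of _ "(q, q) # L"]) auto
    next
      case False
      then have rq: "r < q" using less.prems(1) 3 by auto
      have "\<exists>L. zs = cycle_word L \<and> sorted_wrt (<) (map snd L) \<and> (\<forall>(a, b)\<in>set L. a \<le> b)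
          \<and> (L \<noteq> [] \<longrightarrow> snd (hd L) = hd zs)"
      proof (rule less.hyps)
        show "p' < r'" if "zs = us @ [p', q', r'] @ vs" "q' < p'" for us p' q' r' vs
          using avoid[of "q # r # us" p' q' r' vs] that 3 by simp
      qed (use 3 less.prems(1) in auto)
      then obtain L where L: "zs = cycle_word L" "sorted_wrt (<) (map snd L)"
          "\<forall>(a, b)\<in>set L. a \<le> b" "L \<noteq> [] \<longrightarrow> snd (hd L) = hd zs" by auto
      have "q < snd (hd L)" if "L \<noteq> []"
      proof -
        have "zs \<noteq> []" using that L(1) by (cases L) (auto split: if_splits)
        then show ?thesis using avoid[of "[]" q r "hd zs" "tl zs"] 3 rq L(4) that by simp
      qed
      from cons[OF L(2) this] show ?thesis
        using 3 rq L by (intro exI[of _ "(r, q) # L"]) auto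
    qed
  qed
qed

subsection \<open>One-line words\<close>

lemma length_one_line [simp]: "length (one_line n u) = n"
  by (simp add: one_line_def)

lemma one_line_nth: "k < n \<Longrightarrow> one_line n u ! k = u (Suc k)"
  by (simp add: one_line_def del: upt_Suc)

lemma distinct_one_line: "u \<in> Sn n \<Longrightarrow> distinct (one_line n u)"
  by (auto simp: one_line_def distinct_map permutes_inj_on simp del: upt_Suc)

lemma set_one_line: "u \<in> Sn n \<Longrightarrow> set (one_line n u) = {1..n}"
  by (auto simp: one_line_def permutes_image atLeastLessThanSuc_atLeastAtMost simp del: upt_Suc)

lemma one_line_inj:
  assumes "u \<in> Sn n" "v \<in> Sn n" "one_line n u = one_line n v"
  shows "u = v"
proof
  fix p
  show "u p = v p"
  proof (cases "p \<in> {1..n}")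
    case True
    then show ?thesis using one_line_nth[of "p - 1" n u] one_line_nth[of "p - 1" n v] assms(3) by auto
  next
    case False
    then show ?thesis using assms(1,2) by (metis mem_Collect_eq permutes_not_in)
  qed
qed

lemma one_line_append_Cons:
  assumes "u \<in> Sn n" "one_line n u = us @ z # vs"
  shows "inv u z = Suc (length us)"
proof -
  have "length us < n" using arg_cong[OF assms(2), of length] by simp
  then have "u (Suc (length us)) = z" using one_line_nth[of "length us" n u] assms(2) by simp
  then show ?thesis using assms(1) by (metis mem_Collect_eq permutes_inverses(2))
qed

text \<open>If earlier cycles are smaller in at least one coordinate, a cycle below another in both
  coordinates cannot come later. This form of \<open>ord\<close> covers sorting by smaller ends and
  by larger ends.\<close>

lemma cycle_aligned_cycle_invol:
  assumes u: "u \<in> Sn n" "one_line n u = cycle_word L" and le: "\<forall>(a, b)\<in>set L. a \<le> b"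
    and ord: "sorted_wrt (\<lambda>p q. fst p < fst q \<or> snd p < snd q) L"
  shows "cycle_aligned (cycle_invol L) u"
proof -
  define y where "y = cycle_invol L"
  have dist: "distinct (cycle_word L)" using distinct_one_line[OF u(1)] u(2) by simp
  have sett: "set (cycle_word L) = {1..n}" using set_one_line[OF u(1)] u(2) by simp
  note C = Cyc_cycle_invol[OF dist sett le, folded y_def]
  have yp: "y permutes {1..n}" unfolding y_def using cycle_invol_permutes sett by blast
  have up: "inv u permutes {1..n}" using Sn_inv[OF u(1)] by simp
  have inL: "(a, y a) \<in> set L" if "a \<in> {1..n}" "a \<le> y a" for a
    using that permutes_in_image[OF yp, of a] by (simp add: C[symmetric] Cyc_def)
  \<comment> \<open>A block ends with the smaller entry of its cycle, so the position of that entry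
    is found in the same way for fixed points and two-cycles.\<close>
  have block: "\<exists>pre. (if a = b then [a] else [b, a]) = pre @ [a]" for a b :: nat
    by (cases "a = b") auto
  show ?thesis unfolding cycle_aligned_def y_def[symmetric]
  proof (intro conjI allI impI)
    fix a assume a: "a < y a"
    then have "a \<in> {1..n}" using permutes_not_in[OF yp, of a] by (cases "a \<in> {1..n}") auto
    then have "(a, y a) \<in> set L" using inL a by simp
    then obtain L1 L2 where "L = L1 @ (a, y a) # L2" by (meson split_list)
    then have "cycle_word L = cycle_word (L1 @ (a, y a) # L2)" by (rule arg_cong)
    then have "one_line n u = cycle_word L1 @ y a # a # cycle_word L2" using a u(2) by simp
    then have "inv u (y a) = Suc (length (cycle_word L1))"
      "inv u a = Suc (length (cycle_word L1 @ [y a]))"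
      by (intro one_line_append_Cons[OF u(1)]; simp)+
    then show "inv u a = Suc (inv u (y a))" by simp
  next
    fix a b assume ab: "a \<le> y a" "b \<le> y b" "a < b" "y a < y b"
    show "inv u a < inv u b"
    proof (cases "a \<in> {1..n} \<and> b \<in> {1..n}")
      case True
      then have mem: "(a, y a) \<in> set L" "(b, y b) \<in> set L" using inL ab by auto
      obtain L1 L2 where L: "L = L1 @ (a, y a) # L2" using mem(1) by (meson split_list)
      have "(b, y b) \<notin> set L1" using ord ab(3,4) by (auto simp: L sorted_wrt_append)
      then have "(b, y b) \<in> set L2" using mem(2) L ab(3) by auto
      then obtain L3 L4 where L2: "L2 = L3 @ (b, y b) # L4" by (meson split_list)
      obtain pa where pa: "(if a = y a then [a] else [y a, a]) = pa @ [a]" using block by blast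
      obtain pb where pb: "(if b = y b then [b] else [y b, b]) = pb @ [b]" using block by blast
      have w: "one_line n u =
          cycle_word L1 @ (pa @ [a]) @ cycle_word L3 @ (pb @ [b]) @ cycle_word L4"
        unfolding pa[symmetric] pb[symmetric] by (simp add: u(2) L L2)
      have "inv u a = Suc (length (cycle_word L1 @ pa))"
        by (rule one_line_append_Cons[OF u(1)]) (simp add: w)
      moreover have "inv u b = Suc (length (cycle_word L1 @ pa @ [a] @ cycle_word L3 @ pb))"
        by (rule one_line_append_Cons[OF u(1)]) (simp add: w)
      ultimately show ?thesis by simp
    next
      case False
      \<comment> \<open>\<open>cycle_aligned\<close> speaks of all natural numbers; \<open>0\<close>
        lies before, and numbers above \<open>n\<close> lie after, every position in
        \<open>{1..n}\<close>.\<close>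
      have out: "inv u p = p" if "p \<notin> {1..n}" for p using permutes_not_in[OF up that] .
      have inn: "inv u p \<in> {1..n}" if "p \<in> {1..n}" for p using permutes_in_image[OF up, of p] that by simp
      show ?thesis using False ab(3) out[of a] out[of b] inn[of a] inn[of b]
        by (cases "a \<in> {1..n}"; cases "b \<in> {1..n}") auto
    qed
  qed
qed

section \<open>Rearranging three consecutive entries\<close>

lemma one_line_window_comp:
  fixes n :: nat and u r :: "nat \<Rightarrow> nat"
  assumes "one_line n u = us @ [a, b, c] @ vs" and p: "p = Suc (length us)"
    and r: "\<And>j. j \<notin> {p, Suc p, Suc (Suc p)} \<Longrightarrow> r j = j"
  shows "one_line n (u \<circ> r) = us @ [u (r p), u (r (Suc p)), u (r (Suc (Suc p)))] @ vs"
proof (rule nth_equalityI)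
  have len: "n = length us + 3 + length vs" using arg_cong[OF assms(1), of length] by simp
  show "length (one_line n (u \<circ> r)) = length (us @ [u (r p), u (r (Suc p)), u (r (Suc (Suc p)))] @ vs)"
    using len by simp
  fix k assume "k < length (one_line n (u \<circ> r))"
  then have k: "k < n" by simp
  have e: "(us @ [a, b, c] @ vs) ! k = u (Suc k)" using one_line_nth[OF k, of u] assms(1) by simp
  consider "k < length us" | "k = length us" | "k = Suc (length us)" | "k = Suc (Suc (length us))"
    | "k \<ge> length us + 3" by linarith
  then show "one_line n (u \<circ> r) ! k = (us @ [u (r p), u (r (Suc p)), u (r (Suc (Suc p)))] @ vs) ! k"
  proof cases
    case 1
    then show ?thesis using e r[of "Suc k"] p by (simp add: one_line_nth[OF k] nth_append)
  next
    case 5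
    then obtain d where "k = length us + 3 + d" using le_Suc_ex by blast
    moreover have "one_line n (u \<circ> r) ! k = u (r (Suc k))" by (simp add: one_line_nth[OF k])
    ultimately show ?thesis using e r[of "Suc k"] p by (simp add: nth_append)
  qed (use one_line_nth[OF k, of "u \<circ> r"] in \<open>simp_all add: nth_append p\<close>)
qed

lemma one_line_window:
  assumes "one_line n u = us @ [a, b, c] @ vs" "p = Suc (length us)"
  shows "1 \<le> p" "Suc (Suc p) \<le> n" "u p = a" "u (Suc p) = b" "u (Suc (Suc p)) = c"
proof -
  have len: "length us + 3 \<le> n" using arg_cong[OF assms(1), of length] by simp
  then show "1 \<le> p" "Suc (Suc p) \<le> n" using assms(2) by auto
  show "u p = a" "u (Suc p) = b" "u (Suc (Suc p)) = c"
    using one_line_nth[of "length us" n u] one_line_nth[of "Suc (length us)" n u]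
      one_line_nth[of "Suc (Suc (length us))" n u] len
    by (simp_all add: assms nth_append)
qed

lemma ascending_window:
  assumes v: "v \<in> Sn n" "one_line n v = us @ [a, b, c] @ vs" and lt: "a < b" "b < c"
  shows "\<exists>x\<in>Sn n. \<exists>y\<in>Sn n. \<exists>z\<in>Sn n. one_line n x = us @ [c, a, b] @ vs \<and>
    one_line n y = us @ [b, c, a] @ vs \<and> one_line n z = us @ [c, b, a] @ vs \<and>
    dem_sq n x = dem_sq n y \<and> dem_sq n z = dem_sq n y \<and>
    cox_length n x = cox_length n y \<and> cox_length n y < cox_length n z"
proof -
  define p where "p = Suc (length us)"
  let ?s = "simple_refl p" and ?t = "simple_refl (Suc p)"
  note w = one_line_window[OF v(2) p_def]
  have s: "?s \<in> Sn n" and t: "?t \<in> Sn n" using w by (intro simple_refl_permutes; simp)+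
  have "v p < v (Suc p)" "v (Suc p) < v (Suc (Suc p))" using w lt by simp_all
  note three = dem_sq_three[OF v(1) w(1,2) this]
  have mem: "v \<circ> ?t \<circ> ?s \<in> Sn n" "v \<circ> ?s \<circ> ?t \<in> Sn n" "v \<circ> ?t \<circ> ?s \<circ> ?t \<in> Sn n"
    using v(1) s t Sn_compose by metis+
  have words: "one_line n (v \<circ> ?t \<circ> ?s) = us @ [c, a, b] @ vs"
    "one_line n (v \<circ> ?s \<circ> ?t) = us @ [b, c, a] @ vs"
    "one_line n (v \<circ> ?t \<circ> ?s \<circ> ?t) = us @ [c, b, a] @ vs"
    using one_line_window_comp[OF v(2) p_def, of "?t \<circ> ?s"]
      one_line_window_comp[OF v(2) p_def, of "?s \<circ> ?t"]
      one_line_window_comp[OF v(2) p_def, of "?t \<circ> ?s \<circ> ?t"] w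
    by (simp_all add: comp_assoc)
  show ?thesis
    by (rule bexI[OF bexI[OF bexI[OF _ mem(3)] mem(2)] mem(1)]) (intro conjI words three)
qed

text \<open>Leads back to the ascending arrangement, from which \<open>ascending_window\<close>
  compares the others. Each case composes with the inverse rearrangement.\<close>

lemma sort_window:
  assumes u: "u \<in> Sn n" "one_line n u = us @ [q1, q2, q3] @ vs"
    and abc: "(q1, q2, q3) \<in> {(c, a, b), (b, c, a), (c, b, a)}"
  shows "\<exists>v\<in>Sn n. one_line n v = us @ [a, b, c] @ vs"
proof -
  define p where "p = Suc (length us)"
  let ?s = "simple_refl p" and ?t = "simple_refl (Suc p)"
  note w = one_line_window[OF u(2) p_def]
  have s: "?s \<in> Sn n" and t: "?t \<in> Sn n" using w by (intro simple_refl_permutes; simp)+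
  have "u \<circ> (?t \<circ> ?s) \<in> Sn n" "u \<circ> (?s \<circ> ?t) \<in> Sn n" "u \<circ> (?t \<circ> ?s \<circ> ?t) \<in> Sn n"
    using u(1) s t Sn_compose by metis+
  moreover have "one_line n (u \<circ> (?t \<circ> ?s)) = us @ [q3, q1, q2] @ vs"
    using one_line_window_comp[OF u(2) p_def, of "?t \<circ> ?s"] w by simp
  moreover have "one_line n (u \<circ> (?s \<circ> ?t)) = us @ [q2, q3, q1] @ vs"
    using one_line_window_comp[OF u(2) p_def, of "?s \<circ> ?t"] w by simp
  moreover have "one_line n (u \<circ> (?t \<circ> ?s \<circ> ?t)) = us @ [q3, q2, q1] @ vs"
    using one_line_window_comp[OF u(2) p_def, of "?t \<circ> ?s \<circ> ?t"] w by simp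
  ultimately show ?thesis using abc by auto
qed

text \<open>Both arrangements come from one ascending permutation; injectivity of
  \<open>one_line\<close> identifies \<open>u\<close> with the matching one.\<close>

lemma window_cab_bca:
  assumes "u \<in> Sn n" "one_line n u = us @ [c, a, b] @ vs" "a < b" "b < c"
  shows "\<exists>v\<in>Sn n. one_line n v = us @ [b, c, a] @ vs \<and> dem_sq n v = dem_sq n u \<and>
    cox_length n v = cox_length n u"
proof -
  obtain w where w: "w \<in> Sn n" "one_line n w = us @ [a, b, c] @ vs"
    using sort_window[OF assms(1,2), of c a b] by blast
  from ascending_window[OF w assms(3,4)] show ?thesis
    using one_line_inj[OF assms(1)] assms(2) by metis
qed

lemma window_bca_cab:
  assumes "u \<in> Sn n" "one_line n u = us @ [b, c, a] @ vs" "a < b" "b < c"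
  shows "\<exists>v\<in>Sn n. one_line n v = us @ [c, a, b] @ vs \<and> dem_sq n v = dem_sq n u \<and>
    cox_length n v = cox_length n u"
proof -
  obtain w where w: "w \<in> Sn n" "one_line n w = us @ [a, b, c] @ vs"
    using sort_window[OF assms(1,2), of c a b] by blast
  from ascending_window[OF w assms(3,4)] show ?thesis
    using one_line_inj[OF assms(1)] assms(2) by metis
qed

lemma window_cba:
  assumes "u \<in> Sn n" "one_line n u = us @ [c, b, a] @ vs" "a < b" "b < c"
  shows "\<exists>v\<in>Sn n. dem_sq n v = dem_sq n u \<and> cox_length n v < cox_length n u"
proof -
  obtain w where w: "w \<in> Sn n" "one_line n w = us @ [a, b, c] @ vs"
    using sort_window[OF assms(1,2), of c a b] by blast
  from ascending_window[OF w assms(3,4)] show ?thesis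
    using one_line_inj[OF assms(1)] assms(2) by metis
qed

subsection \<open>The order on inverse atoms\<close>

text \<open>\<open>dem_sq n (inv w)\<close> is the product in the definition of atoms, and inversion
  preserves length, so minimality can be tested on \<open>u\<close> itself.\<close>

lemma inv_atoms_iff:
  "u \<in> inv ` atoms n x \<longleftrightarrow> u \<in> Sn n \<and> dem_sq n u = x \<and>
    (\<forall>v\<in>Sn n. dem_sq n v = x \<longrightarrow> cox_length n u \<le> cox_length n v)"
proof -
  have ii: "inv (inv w) = w" if "w \<in> Sn n" for w using that by (simp add: permutes_inv_inv)
  have at: "w \<in> atoms n x \<longleftrightarrow> w \<in> Sn n \<and> dem_sq n (inv w) = x \<and>
      (\<forall>v\<in>Sn n. dem_sq n (inv v) = x \<longrightarrow> cox_length n w \<le> cox_length n v)" for w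
    unfolding atoms_def is_arg_min_def dem_sq_def mem_Collect_eq[of w] using ii
    by (auto simp: not_less)
  show ?thesis
  proof
    assume "u \<in> inv ` atoms n x"
    then obtain w where w: "u = inv w" "w \<in> atoms n x" by blast
    then have wS: "w \<in> Sn n" and wx: "dem_sq n u = x"
      and wm: "\<And>v. v \<in> Sn n \<Longrightarrow> dem_sq n (inv v) = x \<Longrightarrow> cox_length n w \<le> cox_length n v"
      using at by blast+
    have "cox_length n u \<le> cox_length n v" if "v \<in> Sn n" "dem_sq n v = x" for v
      using wm[OF Sn_inv[OF that(1)]] ii[OF that(1)] that cox_length_inv[OF that(1)]
        cox_length_inv[OF wS] w(1) by simp
    then show "u \<in> Sn n \<and> dem_sq n u = x \<and>
        (\<forall>v\<in>Sn n. dem_sq n v = x \<longrightarrow> cox_length n u \<le> cox_length n v)"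
      using wx w(1) Sn_inv[OF wS] by blast
  next
    assume u: "u \<in> Sn n \<and> dem_sq n u = x \<and>
        (\<forall>v\<in>Sn n. dem_sq n v = x \<longrightarrow> cox_length n u \<le> cox_length n v)"
    have "cox_length n (inv u) \<le> cox_length n v" if "v \<in> Sn n" "dem_sq n (inv v) = x" for v
      using u that Sn_inv[OF that(1)] cox_length_inv[OF that(1)] cox_length_inv[of u n] by metis
    then have "inv u \<in> atoms n x" using u ii[of u] Sn_inv[of u n] unfolding at by metis
    then show "u \<in> inv ` atoms n x" using u ii[of u] by (metis imageI)
  qed
qed

lemma inv_atoms_transfer:
  assumes "u \<in> inv ` atoms n x" "v \<in> Sn n" "dem_sq n v = dem_sq n u" "cox_length n v = cox_length n u"
  shows "v \<in> inv ` atoms n x"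
  using assms unfolding inv_atoms_iff by simp

lemma strict_window:
  assumes "distinct (us @ [p, q, r] @ vs)"
  shows "p \<noteq> q" "q \<noteq> r" "p \<noteq> r"
  using assms by auto

text \<open>In a permutation the weak inequalities of \<open>stepA\<close> are strict, so the
  rearrangement keeps the Demazure square and the length, and with them minimality.\<close>

lemma inv_atoms_step_up:
  assumes u: "u \<in> inv ` atoms n x" and step: "stepA (one_line n u) ys"
  shows "\<exists>v\<in>inv ` atoms n x. ys = one_line n v"
proof -
  have uS: "u \<in> Sn n" using u by (simp add: inv_atoms_iff)
  from step obtain a b c us vs where e: "one_line n u = us @ [c, a, b] @ vs"
      "ys = us @ [b, c, a] @ vs" "a \<le> b" "b \<le> c" by (cases rule: stepA.cases) auto
  have "a < b" "b < c" using e strict_window distinct_one_line[OF uS] by (metis le_neq_implies_less)+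
  from window_cab_bca[OF uS e(1) this] show ?thesis using inv_atoms_transfer[OF u] e(2) by metis
qed

lemma inv_atoms_step_down:
  assumes u: "u \<in> inv ` atoms n x" and step: "stepA ys (one_line n u)"
  shows "\<exists>v\<in>inv ` atoms n x. ys = one_line n v"
proof -
  have uS: "u \<in> Sn n" using u by (simp add: inv_atoms_iff)
  from step obtain a b c us vs where e: "one_line n u = us @ [b, c, a] @ vs"
      "ys = us @ [c, a, b] @ vs" "a \<le> b" "b \<le> c" by (cases rule: stepA.cases) auto
  have "a < b" "b < c" using e strict_window distinct_one_line[OF uS] by (metis le_neq_implies_less)+
  from window_bca_cab[OF uS e(1) this] show ?thesis using inv_atoms_transfer[OF u] e(2) by metis
qed

text \<open>Rearranging such a factor would give a shorter permutation with the same Demazure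
  square.\<close>

lemma inv_atoms_no_cba:
  assumes u: "u \<in> inv ` atoms n x" and e: "one_line n u = us @ [c, b, a] @ vs"
  shows "\<not> (a < b \<and> b < c)"
proof
  assume "a < b \<and> b < c"
  then obtain v where "v \<in> Sn n" "dem_sq n v = dem_sq n u" "cox_length n v < cox_length n u"
    using window_cba[OF _ e] u unfolding inv_atoms_iff by blast
  then show False using u unfolding inv_atoms_iff by fastforce
qed

lemma inv_atoms_minimal:
  assumes u: "u \<in> inv ` atoms n x" and min: "\<And>ys. \<not> stepA ys (one_line n u)"
  shows "one_line n u = hat0 n x"
proof -
  have uS: "u \<in> Sn n" using u by (simp add: inv_atoms_iff)
  note dist = distinct_one_line[OF uS] and sett = set_one_line[OF uS]
  \<comment> \<open>Otherwise \<open>p, q, r\<close> is a factor \<open>b, c, a\<close>, which has a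
    step below it, or \<open>c, b, a\<close>, which an inverse atom lacks.\<close>
  have avoid: "p < r" if e: "one_line n u = us @ [p, q, r] @ vs" and "r < q" for us p q r vs
  proof (rule ccontr)
    assume "\<not> p < r"
    then have rp: "r < p" and pq: "p \<noteq> q" using strict_window[OF dist[unfolded e]] by simp_all
    show False
    proof (cases "p < q")
      case True
      have "stepA (us @ [q, r, p] @ vs) (us @ [p, q, r] @ vs)"
        by (rule stepA.intros) (use rp True in simp_all)
      then show False using min[unfolded e] by blast
    next
      case False
      then show False using inv_atoms_no_cba[OF u e] pq \<open>r < q\<close> by simp
    qed
  qed
  \<comment> \<open>The sentinel \<open>0\<close> is below every entry, so windows starting with it
    satisfy the hypothesis.\<close>
  have "\<exists>L. one_line n u = cycle_word L \<and> sorted_wrt (<) (0 # map fst L) \<and> (\<forall>(a, b)\<in>set L. a \<le> b)"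
  proof (rule avoiding_imp_cycle_word_fst[OF dist])
    have pos: "0 < z" if "z \<in> set (one_line n u)" for z using that sett by auto
    show "0 < hd (one_line n u)" if "one_line n u \<noteq> []" using pos that by simp
    show "p < r" if "0 # one_line n u = us @ [p, q, r] @ vs" "r < q" for us p q r vs
    proof (cases us)
      case Nil
      then show ?thesis using that pos by (simp)
    next
      case (Cons z zs)
      then show ?thesis using that avoid by simp
    qed
  qed
  then obtain L where L: "one_line n u = cycle_word L" "sorted_wrt (<) (map fst L)"
      "\<forall>(a, b)\<in>set L. a \<le> b" by auto
  have d: "distinct (cycle_word L)" "set (cycle_word L) = {1..n}" using dist sett L(1) by simp_all
  have "sorted_wrt (\<lambda>p q. fst p < fst q \<or> snd p < snd q) L"
    using L(2) by (auto simp: sorted_wrt_map intro: sorted_wrt_mono_rel[rotated])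
  \<comment> \<open>The Demazure square is computed from the cycles, while it equals
    \<open>x\<close> for an inverse atom; this identifies the involution.\<close>
  then have "dem_sq n u = cycle_invol L"
    using dem_sq_cycle_aligned[OF uS] cycle_aligned_cycle_invol[OF uS L(1,3)]
      cycle_invol_invol[OF d(1)] cycle_invol_permutes[of L "{1..n}"] d(2) by simp
  then have "x = cycle_invol L" using u by (simp add: inv_atoms_iff)
  then show ?thesis using hat0_cycle_invol[OF d L(3,2)] L(1) by simp
qed

lemma inv_atoms_maximal:
  assumes u: "u \<in> inv ` atoms n x" and max: "\<And>ys. \<not> stepA (one_line n u) ys"
  shows "one_line n u = hat1 n x"
proof -
  have uS: "u \<in> Sn n" using u by (simp add: inv_atoms_iff)
  note dist = distinct_one_line[OF uS] and sett = set_one_line[OF uS]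
  \<comment> \<open>Otherwise \<open>p, q, r\<close> is a factor \<open>c, a, b\<close>, which has a
    step above it, or \<open>c, b, a\<close>.\<close>
  have avoid: "p < r" if e: "one_line n u = us @ [p, q, r] @ vs" and "q < p" for us p q r vs
  proof (rule ccontr)
    assume "\<not> p < r"
    then have rp: "r < p" and qr: "q \<noteq> r" using strict_window[OF dist[unfolded e]] by simp_all
    show False
    proof (cases "q < r")
      case True
      have "stepA (us @ [p, q, r] @ vs) (us @ [r, p, q] @ vs)"
        by (rule stepA.intros) (use rp True in simp_all)
      then show False using max[unfolded e] by blast
    next
      case False
      then show False using inv_atoms_no_cba[OF u e] qr \<open>q < p\<close> by simp
    qed
  qed
  have "\<exists>L. one_line n u = cycle_word L \<and> sorted_wrt (<) (map snd L) \<and> (\<forall>(a, b)\<in>set L. a \<le> b)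
      \<and> (L \<noteq> [] \<longrightarrow> snd (hd L) = hd (one_line n u))"
    by (rule avoiding_imp_cycle_word_snd[OF dist]) (rule avoid)
  then obtain L where L: "one_line n u = cycle_word L" "sorted_wrt (<) (map snd L)"
      "\<forall>(a, b)\<in>set L. a \<le> b" by blast
  have d: "distinct (cycle_word L)" "set (cycle_word L) = {1..n}" using dist sett L(1) by simp_all
  have "sorted_wrt (\<lambda>p q. fst p < fst q \<or> snd p < snd q) L"
    using L(2) by (auto simp: sorted_wrt_map intro: sorted_wrt_mono_rel[rotated])
  then have "dem_sq n u = cycle_invol L"
    using dem_sq_cycle_aligned[OF uS] cycle_aligned_cycle_invol[OF uS L(1,3)]
      cycle_invol_invol[OF d(1)] cycle_invol_permutes[of L "{1..n}"] d(2) by simp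
  then have "x = cycle_invol L" using u by (simp add: inv_atoms_iff)
  then show ?thesis using hat1_cycle_invol[OF d L(3,2)] L(1) by simp
qed

section \<open>Chains to the extremal words\<close>

lemma preceqA_rtranclp: "preceqA xs ys \<longleftrightarrow> stepA\<^sup>*\<^sup>* xs ys"
  unfolding preceqA_def precA_def by (metis rtranclpD tranclp_into_rtranclp rtranclp.rtrancl_refl)

text \<open>Steps are restricted to permutations so that the relation is finite.\<close>

definition step_rel :: "nat \<Rightarrow> ((nat \<Rightarrow> nat) \<times> (nat \<Rightarrow> nat)) set"
  where "step_rel n = {(u, v). u \<in> Sn n \<and> v \<in> Sn n \<and> stepA (one_line n u) (one_line n v)}"

text \<open>An upward step replaces \<open>c\<close> by the smaller \<open>b\<close> at the first
  changed place, so words decrease lexicographically and upward chains end. The relation is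
  therefore acyclic, and finiteness gives the other direction.\<close>

lemma wf_step_rel: "wf (step_rel n)" "wf ((step_rel n)\<inverse>)"
proof -
  have "(one_line n v, one_line n u) \<in> lex less_than" if "(u, v) \<in> step_rel n" for u v
  proof -
    from that have uS: "u \<in> Sn n" and "stepA (one_line n u) (one_line n v)" by (auto simp: step_rel_def)
    from this(2) obtain a b c us vs where e: "one_line n u = us @ [c, a, b] @ vs"
      "one_line n v = us @ [b, c, a] @ vs" "b \<le> c" by (cases rule: stepA.cases) auto
    have "b < c" using e strict_window distinct_one_line[OF uS] by (metis le_neq_implies_less)
    then show ?thesis unfolding lex_conv using e by force
  qed
  then have "(step_rel n)\<inverse> \<subseteq> inv_image (lex less_than) (one_line n)" by auto
  then show "wf ((step_rel n)\<inverse>)"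
    using wf_subset wf_inv_image wf_lex wf_less_than by metis
  then have "acyclic (step_rel n)" using wf_acyclic acyclic_converse by blast
  moreover have "finite (step_rel n)"
  proof (rule finite_subset)
    show "step_rel n \<subseteq> Sn n \<times> Sn n" by (auto simp: step_rel_def)
  qed (simp add: finite_permutations)
  ultimately show "wf (step_rel n)" by (rule finite_acyclic_wf[rotated])
qed

text \<open>Going down step by step stays among the inverse atoms and must stop; the word where it
  stops is minimal, hence \<open>hat0 n x\<close>.\<close>

lemma hat0_below:
  assumes "u \<in> inv ` atoms n x"
  shows "stepA\<^sup>*\<^sup>* (hat0 n x) (one_line n u)"
  using wf_step_rel(1)[of n] assms
proof (induction u rule: wf_induct_rule)
  case (less u)
  show ?case
  proof (cases "\<exists>ys. stepA ys (one_line n u)")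
    case True
    then obtain v where v: "v \<in> inv ` atoms n x" "stepA (one_line n v) (one_line n u)"
      using inv_atoms_step_down[OF less.prems] by blast
    then have "(v, u) \<in> step_rel n" using less.prems by (simp add: inv_atoms_iff step_rel_def)
    from less.IH[OF this v(1)] v(2) show ?thesis by (rule rtranclp.rtrancl_into_rtrancl)
  next
    case False
    then show ?thesis using inv_atoms_minimal[OF less.prems] by simp
  qed
qed

lemma hat1_above:
  assumes "u \<in> inv ` atoms n x"
  shows "stepA\<^sup>*\<^sup>* (one_line n u) (hat1 n x)"
  using wf_step_rel(2)[of n] assms
proof (induction u rule: wf_induct_rule)
  case (less u)
  show ?case
  proof (cases "\<exists>ys. stepA (one_line n u) ys")
    case True
    then obtain v where v: "v \<in> inv ` atoms n x" "stepA (one_line n u) (one_line n v)"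
      using inv_atoms_step_up[OF less.prems] by blast
    then have "(v, u) \<in> (step_rel n)\<inverse>" using less.prems by (simp add: inv_atoms_iff step_rel_def)
    from v(2) less.IH[OF this v(1)] show ?thesis by (rule converse_rtranclp_into_rtranclp)
  next
    case False
    then show ?thesis using inv_atoms_maximal[OF less.prems] by simp
  qed
qed

lemma inv_atoms_up_closed:
  assumes "u \<in> inv ` atoms n x" "stepA\<^sup>*\<^sup>* (one_line n u) ys"
  shows "\<exists>v\<in>inv ` atoms n x. ys = one_line n v"
  using assms(2,1) by (induction rule: rtranclp_induct) (blast intro: inv_atoms_step_up)+

lemma inv_atoms_down_closed:
  assumes "u \<in> inv ` atoms n x" "stepA\<^sup>*\<^sup>* ys (one_line n u)"
  shows "\<exists>v\<in>inv ` atoms n x. ys = one_line n v"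
  using assms(2,1) by (induction rule: converse_rtranclp_induct) (blast intro: inv_atoms_step_down)+

lemma inv_atoms_nonempty:
  assumes "x \<in> Sn n" "x \<circ> x = id"
  shows "\<exists>u. u \<in> inv ` atoms n x"
proof -
  obtain u where "u \<in> Sn n \<and> dem_sq n u = x" using ex_dem_sq[OF assms] by blast
  from ex_has_least_nat[of "\<lambda>u. u \<in> Sn n \<and> dem_sq n u = x", OF this, of "cox_length n"]
  show ?thesis unfolding inv_atoms_iff by blast
qed

theorem theorem6p11:
  fixes n :: nat and x :: "nat \<Rightarrow> nat"
  assumes "x \<in> Sn n" and "x \<circ> x = id"
  shows "inv ` atoms n x = {u \<in> Sn n. preceqA (hat0 n x) (one_line n u)} \<and>
         inv ` atoms n x = {u \<in> Sn n. preceqA (one_line n u) (hat1 n x)}"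
proof -
  obtain w where w: "w \<in> inv ` atoms n x" using inv_atoms_nonempty[OF assms] by blast
  \<comment> \<open>The extremal words are themselves words of inverse atoms, since steps from
    \<open>w\<close> lead to them without leaving this set.\<close>
  obtain u0 where u0: "u0 \<in> inv ` atoms n x" "hat0 n x = one_line n u0"
    using inv_atoms_down_closed[OF w hat0_below[OF w]] by blast
  obtain u1 where u1: "u1 \<in> inv ` atoms n x" "hat1 n x = one_line n u1"
    using inv_atoms_up_closed[OF w hat1_above[OF w]] by blast
  have sub: "u \<in> Sn n" if "u \<in> inv ` atoms n x" for u using that unfolding inv_atoms_iff by blast
  \<comment> \<open>Closure gives an inverse atom with the same word as \<open>u\<close>, and
    injectivity of \<open>one_line\<close> makes it equal to \<open>u\<close>.\<close>
  have up: "u \<in> inv ` atoms n x" if u: "u \<in> Sn n" "stepA\<^sup>*\<^sup>* (hat0 n x) (one_line n u)" for u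
    using inv_atoms_up_closed[OF u0(1), of "one_line n u"] u u0(2) one_line_inj sub by metis
  have down: "u \<in> inv ` atoms n x" if u: "u \<in> Sn n" "stepA\<^sup>*\<^sup>* (one_line n u) (hat1 n x)" for u
    using inv_atoms_down_closed[OF u1(1), of "one_line n u"] u u1(2) one_line_inj sub by metis
  show ?thesis unfolding preceqA_rtranclp
  proof (intro conjI equalityI subsetI CollectI)
    fix u assume u: "u \<in> inv ` atoms n x"
    show "u permutes {1..n}" "u permutes {1..n}" using sub[OF u] by simp_all
    show "stepA\<^sup>*\<^sup>* (hat0 n x) (one_line n u)" using u by (rule hat0_below)
    show "stepA\<^sup>*\<^sup>* (one_line n u) (hat1 n x)" using u by (rule hat1_above)
  next
    fix u assume u: "u \<in> {u \<in> Sn n. stepA\<^sup>*\<^sup>* (hat0 n x) (one_line n u)}"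
    show "u \<in> inv ` atoms n x" by (rule up) (use u in simp_all)
  next
    fix u assume u: "u \<in> {u \<in> Sn n. stepA\<^sup>*\<^sup>* (one_line n u) (hat1 n x)}"
    show "u \<in> inv ` atoms n x" by (rule down) (use u in simp_all)
  qed
qed

end
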